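(* Let $q$ be real with $0<|q|<1$, let $c\in\mathbb{R}$, $b<0$ and $\lambda\in\mathbb{R}$, and suppose that $1+\lambda q^k/b>0$ for all $k\ge1$. For $x=\cos\vartheta\in(-1,1)$ with $\vartheta\in(0,\pi)$, let $$\mu'(x)=\frac{2}{\pi}\,\frac{(-\lambda q/b;q)_\infty}{|R|^2\sqrt{1-x^2}},\qquad R=\frac{-1}{i\sin\vartheta}\sum_{m=0}^{\infty}\frac{(-\lambda q e^{i\vartheta}/2bc;q)_m}{(q;q)_m\,(qe^{2i\vartheta};q)_m}(-2c)^m e^{im\vartheta}q^{\binom m2},$$ which is the density on $(-1,1)$ of the absolutely continuous component of the orthogonality measure of the polynomials defined by $P_0(x)=1$, $P_1(x)=x-c$, and $xP_k(x)=P_{k+1}(x)+cq^kP_k(x)+\tfrac14(1+\lambda q^k/b)P_{k-1}(x)$ for $k>0$. Define $$F(\rho)=\sum_{m=0}^{\infty}\frac{(-\lambda q\rho/2bc;q)_m}{(q;q)_m(q\rho^2;q)_m}(-2c\rho)^m q^{\binom{m+1}{2}},\qquad G(\rho)=\sum_{m=0}^{\infty}\frac{(-\lambda q\rho/2bc;q)_m}{(q;q)_m(q\rho^2;q)_m}(-2c\rho)^m q^{\binom{m}{2}},$$ and put $\rho_1=e^{-i\vartheta}$, $\rho_2=e^{i\vartheta}$. Then for all $x=\cos\vartheta\in(-1,1)$, $\vartheta\in(0,\pi)$, $$\mu'(x)=\frac{1}{\pi i}\left(\rho_2\frac{F(\rho_2)}{G(\rho_2)}-\rho_1\frac{F(\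rho_1)}{G(\rho_1)}\right).$$
   Context: $q$-rising factorials: $(a;q)_0=1$, $(a;q)_n=(1-a)(1-aq)\cdots(1-aq^{n-1})$ for $n\ge1$, and $(a;q)_\infty=\prod_{k\ge0}(1-aq^k)$ for $|q|<1$. The expression $-\lambda q\rho/2bc$ means $-\lambda q\rho/(2bc)$. When $c=0$, the product $(-\lambda q\rho/2bc;q)_m(-2c\rho)^m$ is understood as its continuous extension $\rho^m\prod_{j=0}^{m-1}\left(-2c-\lambda q^{j+1}\rho/b\right)$ (and likewise in $R$, with $\rho=e^{i\vartheta}$). The orthogonality measure is the positive measure $\mu$ with $\int P_nP_m\,d\mu=4^{-n}(-\lambda q/b;q)_n\delta_{mn}$. *)

theory Defs
  imports "HOL-Analysis.Analysis" "HOL-Computational_Algebra.Polynomial"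
begin

definition qpoch :: "'a::comm_ring_1 \<Rightarrow> 'a \<Rightarrow> nat \<Rightarrow> 'a" where
  "qpoch a q n = (\<Prod>k<n. 1 - a * q ^ k)"

definition qpoch_inf :: "'a::real_normed_field \<Rightarrow> 'a \<Rightarrow> 'a" where
  "qpoch_inf a q = (\<Prod>k. 1 - a * q ^ k)"

text \<open>
  The product $(-\lambda q\rho/(2bc);q)_m\,(-2c\rho)^m$. For $c = 0$ it is replaced by its
  continuous extension, because division by zero would otherwise yield $0$ for $m > 0$.
\<close>

definition qnumer :: "real \<Rightarrow> real \<Rightarrow> real \<Rightarrow> real \<Rightarrow> complex \<Rightarrow> nat \<Rightarrow> complex" where
  "qnumer q c b lam \<rho> m =
     (if c = 0
      then \<rho> ^ m * (\<Prod>j<m. - 2 * of_real c - of_real lam * of_real q ^ (j + 1) * \<rho> / of_real b)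
      else qpoch (- (of_real lam * of_real q * \<rho> / (2 * of_real b * of_real c))) (of_real q) m
             * (- 2 * of_real c * \<rho>) ^ m)"

definition F_series :: "real \<Rightarrow> real \<Rightarrow> real \<Rightarrow> real \<Rightarrow> complex \<Rightarrow> complex" where
  "F_series q c b lam \<rho> =
     (\<Sum>m. qnumer q c b lam \<rho> m
            / (qpoch (of_real q) (of_real q) m * qpoch (of_real q * \<rho>\<^sup>2) (of_real q) m)
            * of_real q ^ ((m + 1) choose 2))"

definition G_series :: "real \<Rightarrow> real \<Rightarrow> real \<Rightarrow> real \<Rightarrow> complex \<Rightarrow> complex" where
  "G_series q c b lam \<rho> =
     (\<Sum>m. qnumer q c b lam \<rho> m
            / (qpoch (of_real q) (of_real q) m * qpoch (of_real q * \<rho>\<^sup>2) (of_real q) m)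
            * of_real q ^ (m choose 2))"

definition R_fun :: "real \<Rightarrow> real \<Rightarrow> real \<Rightarrow> real \<Rightarrow> real \<Rightarrow> complex" where
  "R_fun q c b lam \<theta> =
     - 1 / (\<i> * of_real (sin \<theta>)) *
     (\<Sum>m. qnumer q c b lam (exp (\<i> * of_real \<theta>)) m
            / (qpoch (of_real q) (of_real q) m
                * qpoch (of_real q * exp (2 * \<i> * of_real \<theta>)) (of_real q) m)
            * of_real q ^ (m choose 2))"

text \<open>For $x = \cos\vartheta$ with $\vartheta \in (0,\pi)$, the angle $\vartheta$ is \<open>arccos x\<close>.\<close>

definition mu_density :: "real \<Rightarrow> real \<Rightarrow> real \<Rightarrow> real \<Rightarrow> real \<Rightarrow> real" where
  "mu_density q c b lam x =
     2 / pi * (qpoch_inf (- (lam * q / b)) q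
               / ((cmod (R_fun q c b lam (arccos x)))\<^sup>2 * sqrt (1 - x\<^sup>2)))"

definition orth_polys :: "real \<Rightarrow> real \<Rightarrow> real \<Rightarrow> real \<Rightarrow> (nat \<Rightarrow> real poly) \<Rightarrow> bool" where
  "orth_polys q c b lam P \<longleftrightarrow>
     P 0 = 1 \<and> P 1 = [:- c, 1:] \<and>
     (\<forall>k>0. [:0, 1:] * P k =
              P (k + 1) + smult (c * q ^ k) (P k)
              + smult (1 / 4 * (1 + lam * q ^ k / b)) (P (k - 1)))"

definition orthogonality_measure ::
  "real \<Rightarrow> real \<Rightarrow> real \<Rightarrow> (nat \<Rightarrow> real poly) \<Rightarrow> real measure \<Rightarrow> bool" where
  "orthogonality_measure q b lam P M \<longleftrightarrow>
     sets M = sets borel \<and>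
     (\<forall>n m. integrable M (\<lambda>x. poly (P n) x * poly (P m) x) \<and>
            (\<integral>x. poly (P n) x * poly (P m) x \<partial>M) =
              (if m = n then qpoch (- (lam * q / b)) q n / 4 ^ n else 0))"

text \<open>
  \<open>w\<close> is a density on \<open>A\<close> of the absolutely continuous component of \<open>M\<close>: in the Lebesgue
  decomposition \<open>M = N + S\<close> with respect to Lebesgue measure, with \<open>N\<close> absolutely continuous
  and \<open>S\<close> concentrated on a null set, the part \<open>N\<close> is given on \<open>A\<close> by \<open>w\<close>.
\<close>

definition ac_component_density_on :: "real measure \<Rightarrow> real set \<Rightarrow> (real \<Rightarrow> real) \<Rightarrow> bool" where
  "ac_component_density_on M A w \<longleftrightarrow>
     set_borel_measurable lborel A w \<and> (\<forall>x\<in>A. 0 \<le> w x) \<and>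
     (\<exists>N S. sets N = sets borel \<and> sets S = sets borel \<and>
        (\<forall>B\<in>sets borel. emeasure M B = emeasure N B + emeasure S B) \<and>
        absolutely_continuous lborel N \<and>
        (\<exists>Z\<in>null_sets lborel. emeasure S (UNIV - Z) = 0) \<and>
        (\<forall>B\<in>sets borel. B \<subseteq> A \<longrightarrow> emeasure N B = (\<integral>\<^sup>+x\<in>B. ennreal (w x) \<partial>lborel)))"

end

theory Submission
  imports Defs
begin

text \<open>
Put \<open>r = lam / b\<close>. Multiplying \<open>P\<^sub>k\<close> by \<open>2\<^sup>k\<close> and dividing by \<open>\<Prod>j=1..k. 1 + r q\<^sup>j\<close> turns the
recurrence of the orthogonal polynomials into
\<open>2 x u\<^sub>n\<^sub>+\<^sub>1 = (1 + r q\<^sup>n\<^sup>+\<^sup>1) u\<^sub>n\<^sub>+\<^sub>2 + 2 c q\<^sup>n u\<^sub>n\<^sub>+\<^sub>1 + u\<^sub>n\<close>, whose coefficients tend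
geometrically to those of the Chebyshev recurrence. With \<open>2 x = \<rho> + 1 / \<rho>\<close> it therefore has a Jost
solution \<open>J\<^sub>n(\<rho>)\<close>, asymptotic to \<open>\<rho>\<^sup>n\<close>. The ansatz \<open>J\<^sub>n(\<rho>) = \<rho>\<^sup>n S(q\<^sup>n)\<close> with a power series \<open>S\<close>
gives a first-order recursion for the coefficients of \<open>S\<close>; solving it shows \<open>J\<^sub>0(\<rho>) = G(\<rho>)\<close> and
\<open>J\<^sub>1(\<rho>) = \<rho> F(\<rho>)\<close>. So \<open>\<rho> F(\<rho>) / G(\<rho>) = J\<^sub>1(\<rho>) / J\<^sub>0(\<rho>)\<close>, which is a Weyl function.

The displayed identity is a Wronskian. For \<open>\<rho> = exp (i \<theta>)\<close>, both \<open>\<rho>\<close> and its conjugate belong to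
the same \<open>x\<close>, so the Wronskian of the two Jost solutions can be evaluated at infinity
(\<open>jost_wronskian\<close>): it is the infinite product times \<open>2 i sin \<theta>\<close>. Dividing by
\<open>J\<^sub>0(\<rho>) J\<^sub>0(cnj \<rho>) = \<bar>G(\<rho>)\<bar>\<^sup>2\<close> gives the density (\<open>mu_density_eq_jost\<close>).

That this function is the density of the absolutely continuous component is read off from the
Cauchy transform of the measure. For \<open>z\<close> in the upper half-plane the functions of the second kind
\<open>\<integral> P\<^sub>k(t) / (t - z)\<close> form, after the same rescaling, a bounded solution of the recurrence. If \<open>\<rho>\<close> is
the root of \<open>\<rho> + 1 / \<rho> = 2 z\<close> inside the unit disc, then \<open>J\<close> tends to zero, so the Wronskian of the two
solutions vanishes and they are proportional (\<open>bounded_solution_ratio\<close>); hence the Cauchy transform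
equals \<open>- 2 J\<^sub>1(\<rho>) / J\<^sub>0(\<rho>)\<close> (\<open>cauchy_transform_eq\<close>). The right-hand side extends continuously to
the open interval \<open>(-1, 1)\<close>, and Stieltjes inversion (\<open>stieltjes_inversion\<close>) identifies the measure
on that interval with \<open>1 / \<pi>\<close> times the boundary values of its imaginary part.
\<close>

section \<open>The three-term recurrence and its q-series\<close>

text \<open>
The factor \<open>q ^ j\<close> in the product accounts for the power \<open>q ^ (m choose 2)\<close> of the series \<open>G\<close>, and
each numerator is \<open>-2 c \<rho>\<close> times a factor of the q-rising factorial, multiplied out so that \<open>c = 0\<close>
is an ordinary value.
\<close>

definition jost_coeff :: "real \<Rightarrow> real \<Rightarrow> real \<Rightarrow> complex \<Rightarrow> nat \<Rightarrow> complex" where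
  "jost_coeff q c r \<rho> m = (\<Prod>j<m. - \<rho> * of_real q ^ j * (2 * of_real c + of_real r * \<rho> * of_real q ^ Suc j)
      / ((1 - of_real q ^ Suc j) * (1 - \<rho>\<^sup>2 * of_real q ^ Suc j)))"

definition jost_series :: "real \<Rightarrow> real \<Rightarrow> real \<Rightarrow> complex \<Rightarrow> complex \<Rightarrow> complex" where
  "jost_series q c r \<rho> u = (\<Sum>m. jost_coeff q c r \<rho> m * u ^ m)"

definition jost :: "real \<Rightarrow> real \<Rightarrow> real \<Rightarrow> complex \<Rightarrow> nat \<Rightarrow> complex" where
  "jost q c r \<rho> n = \<rho> ^ n * jost_series q c r \<rho> (of_real q ^ n)"

text \<open>
The recurrence is shifted by one: index \<open>0\<close> is the boundary value that the orthogonal polynomials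
would have at \<open>-1\<close>, and the equation for \<open>n = 0\<close> is the one that involves \<open>P 0\<close> and \<open>P 1\<close>.
\<close>

definition solves_rec :: "real \<Rightarrow> real \<Rightarrow> real \<Rightarrow> complex \<Rightarrow> (nat \<Rightarrow> complex) \<Rightarrow> bool" where
  "solves_rec q c r s u \<longleftrightarrow> (\<forall>n. s * u (Suc n) =
     (1 + of_real r * of_real q ^ Suc n) * u (Suc (Suc n)) + 2 * of_real c * of_real q ^ n * u (Suc n) + u n)"

definition weight_prod :: "real \<Rightarrow> real \<Rightarrow> nat \<Rightarrow> real" where
  "weight_prod q r n = (\<Prod>j<n. 1 + r * q ^ Suc j)"

lemma q_power_choose_two:
  fixes x :: "'a::comm_monoid_mult"
  shows "x ^ (m choose 2) = (\<Prod>j<m. x ^ j)"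
proof (induction m)
  case (Suc m)
  have "Suc m choose 2 = m + (m choose 2)"
    by (simp add: numeral_2_eq_2)
  then show ?case
    by (simp only: power_add prod.lessThan_Suc Suc.IH mult.commute)
qed (simp add: numeral_2_eq_2)

lemma term_eq_jost_coeff:
  "qnumer q c b lam \<rho> m / (qpoch (of_real q) (of_real q) m * qpoch (of_real q * \<rho>\<^sup>2) (of_real q) m)
     * of_real q ^ (m choose 2) = jost_coeff q c (lam / b) \<rho> m"
proof -
  have num: "qnumer q c b lam \<rho> m
      = (\<Prod>j<m. - \<rho> * (2 * of_real c + of_real (lam / b) * \<rho> * of_real q ^ Suc j))"
  proof (cases "c = 0")
    case True
    have "\<rho> ^ m = (\<Prod>j<m. \<rho>)" by simp
    then show ?thesis using True
      by (simp add: qnumer_def prod.distrib[symmetric] algebra_simps del: prod_constant)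
  next
    case False
    have "(- 2 * of_real c * \<rho>) ^ m = (\<Prod>j<m. - 2 * of_real c * \<rho>)" by simp
    then have "qnumer q c b lam \<rho> m =
      (\<Prod>j<m. (1 - (- (of_real lam * of_real q * \<rho> / (2 * of_real b * of_real c))) * of_real q ^ j) * (- 2 * of_real c * \<rho>))"
      using False by (simp only: qnumer_def qpoch_def prod.distrib if_False)
    also have "\<dots> = (\<Prod>j<m. - \<rho> * (2 * of_real c + of_real (lam / b) * \<rho> * of_real q ^ Suc j))"
      using False by (intro prod.cong refl, cases "b = 0") (simp_all add: field_simps)
    finally show ?thesis .
  qed
  show ?thesis
    unfolding num q_power_choose_two qpoch_def jost_coeff_def
    by (simp add: prod.distrib[symmetric] prod_dividef[symmetric] mult_ac)
qed

lemma G_series_eq: "G_series q c b lam \<rho> = jost q c (lam / b) \<rho> 0"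
  unfolding G_series_def term_eq_jost_coeff jost_def jost_series_def by simp

text \<open>
The additional power \<open>q ^ m\<close> in \<open>F\<close> moves the argument of the power series from \<open>1\<close> to \<open>q\<close>.
\<close>

lemma F_series_eq: "\<rho> * F_series q c b lam \<rho> = jost q c (lam / b) \<rho> 1"
proof -
  have "Suc m choose 2 = (m choose 2) + m" for m by (simp add: numeral_2_eq_2)
  then have "F_series q c b lam \<rho> = (\<Sum>m. jost_coeff q c (lam / b) \<rho> m * of_real q ^ m)"
    unfolding F_series_def
    by (simp add: term_eq_jost_coeff[symmetric] power_add mult_ac)
  then show ?thesis by (simp add: jost_def jost_series_def)
qed

text \<open>
The terms with \<open>s\<close> and with \<open>c\<close> cancel in the antisymmetric combination, so one step of the recurrence
multiplies the Wronskian by the inverse of \<open>1 + r * q ^ Suc n\<close>; \<open>weight_prod\<close> collects these factors.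
\<close>

lemma wronskian_const:
  assumes "solves_rec q c r s u" "solves_rec q c r s v"
  shows "of_real (weight_prod q r n) * (u (Suc n) * v n - u n * v (Suc n)) = u 1 * v 0 - u 0 * v 1"
proof (induction n)
  case (Suc n)
  let ?a = "1 + of_real r * of_real q ^ Suc n :: complex"
  have u: "?a * u (Suc (Suc n)) = s * u (Suc n) - 2 * of_real c * of_real q ^ n * u (Suc n) - u n"
    and v: "?a * v (Suc (Suc n)) = s * v (Suc n) - 2 * of_real c * of_real q ^ n * v (Suc n) - v n"
    using assms unfolding solves_rec_def by (simp_all add: algebra_simps)
  have "?a * (u (Suc (Suc n)) * v (Suc n) - u (Suc n) * v (Suc (Suc n)))
     = (?a * u (Suc (Suc n))) * v (Suc n) - u (Suc n) * (?a * v (Suc (Suc n)))"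
    by (simp only: algebra_simps)
  also have "\<dots> = u (Suc n) * v n - u n * v (Suc n)"
    unfolding u v by (simp add: algebra_simps)
  finally show ?case using Suc.IH by (simp add: weight_prod_def mult.assoc)
qed (simp add: weight_prod_def)

lemma weight_prod_pos:
  assumes "\<And>k::nat. k \<ge> 1 \<Longrightarrow> 1 + r * q ^ k > 0"
  shows "weight_prod q r n > 0"
  unfolding weight_prod_def using assms[of "Suc _"] by (intro prod_pos) simp

section \<open>The solution that decays at infinity\<close>

locale q_recurrence =
  fixes q c r :: real
  assumes q1: "\<bar>q\<bar> < 1"
begin

lemma weight_prod_limit:
  assumes "\<And>k::nat. k \<ge> 1 \<Longrightarrow> 1 + r * q ^ k > 0"
  shows "weight_prod q r \<longlonglongrightarrow> qpoch_inf (- (r * q)) q" "qpoch_inf (- (r * q)) q > 0"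
proof -
  have "summable (\<lambda>k. norm (r * q * q ^ k))"
    using q1 by (simp add: norm_mult norm_power summable_mult summable_geometric abs_mult power_abs)
  then have cp: "convergent_prod (\<lambda>k. 1 + r * q * q ^ k)"
    by (intro abs_convergent_prod_imp_convergent_prod) (simp add: abs_convergent_prod_conv_summable)
  have pos: "1 + r * q * q ^ k > 0" for k
    using assms[of "Suc k"] by (simp add: mult_ac)
  have eq: "qpoch_inf (- (r * q)) q = (\<Prod>k. 1 + r * q * q ^ k)"
    by (simp add: qpoch_inf_def)
  have "(\<lambda>n. \<Prod>k<Suc n. 1 + r * q * q ^ k) \<longlonglongrightarrow> (\<Prod>k. 1 + r * q * q ^ k)"
    using convergent_prod_LIMSEQ[OF cp] by (simp add: lessThan_Suc_atMost)
  then show "weight_prod q r \<longlonglongrightarrow> qpoch_inf (- (r * q)) q"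
    unfolding eq weight_prod_def filterlim_sequentially_Suc[where f="\<lambda>n. \<Prod>k<n. _ k"]
    by (simp add: filterlim_sequentially_Suc mult_ac)
  have "(\<Prod>k. 1 + r * q * q ^ k) \<noteq> 0"
    using cp pos by (intro prodinf_nonzero) (auto simp: less_imp_neq[THEN not_sym])
  moreover have "(\<Prod>k. 1 + r * q * q ^ k) \<ge> 0"
    by (rule LIMSEQ_le_const[OF convergent_prod_LIMSEQ[OF cp]])
       (intro exI allI impI prod_nonneg less_imp_le pos)
  ultimately show "qpoch_inf (- (r * q)) q > 0" unfolding eq by simp
qed

lemma denominator_ge:
  assumes "norm \<rho> \<le> 1"
  shows "norm ((1 - of_real q ^ Suc j) * (1 - \<rho>\<^sup>2 * of_real q ^ Suc j) :: complex) \<ge> (1 - \<bar>q\<bar>)\<^sup>2"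
proof -
  have a: "norm (1 - w * of_real q ^ Suc j :: complex) \<ge> 1 - \<bar>q\<bar>" if "norm w \<le> 1" for w
  proof -
    have "norm (w * of_real q ^ Suc j) \<le> 1 * \<bar>q\<bar> ^ Suc j"
      using that by (simp add: norm_mult norm_power mult_left_le_one_le)
    also have "\<dots> \<le> \<bar>q\<bar>"
      using q1 power_decreasing[of 1 "Suc j" "\<bar>q\<bar>"] by simp
    finally show ?thesis
      using norm_triangle_ineq2[of 1 "w * of_real q ^ Suc j"] by simp
  qed
  show ?thesis
    unfolding norm_mult[of "_ - _"] power2_eq_square[of "1 - \<bar>q\<bar>"]
    using a[of 1] a[of "\<rho>\<^sup>2"] assms q1 
    by (intro mult_mono) (auto simp: norm_power power_le_one)
qed

lemma denominator_nonzero: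
  assumes "norm \<rho> \<le> 1"
  shows "(1 - of_real q ^ Suc j) \<noteq> (0::complex)" "(1 - \<rho>\<^sup>2 * of_real q ^ Suc j) \<noteq> (0::complex)"
proof -
  have "(1 - \<bar>q\<bar>)\<^sup>2 > 0" using q1 by simp
  then have "(1 - of_real q ^ Suc j) * (1 - \<rho>\<^sup>2 * of_real q ^ Suc j) \<noteq> (0::complex)"
    using denominator_ge[OF assms, of j] by (metis norm_zero not_less)
  then show "(1 - of_real q ^ Suc j) \<noteq> (0::complex)" "(1 - \<rho>\<^sup>2 * of_real q ^ Suc j) \<noteq> (0::complex)"
    by auto
qed

text \<open>
A majorant that does not depend on \<open>\<rho>\<close> in the closed unit disc, where every factor
\<open>1 - \<rho>\<^sup>2 * q ^ Suc j\<close> stays away from zero. It decays like a power of \<open>q\<close> with quadratic exponent,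
so all series converge uniformly there, the boundary circle included.
\<close>

definition coeff_bound :: "nat \<Rightarrow> real" where
  "coeff_bound m = (\<Prod>j<m. (2 * \<bar>c\<bar> + \<bar>r\<bar>) / (1 - \<bar>q\<bar>)\<^sup>2 * \<bar>q\<bar> ^ j)"

lemma norm_jost_coeff_le:
  assumes "norm \<rho> \<le> 1"
  shows "norm (jost_coeff q c r \<rho> m) \<le> coeff_bound m"
proof -
  have n: "norm (- \<rho> * of_real q ^ j * (2 * of_real c + of_real r * \<rho> * of_real q ^ Suc j)) \<le> (2 * \<bar>c\<bar> + \<bar>r\<bar>) * \<bar>q\<bar> ^ j" for j
  proof -
    have "norm (2 * of_real c + of_real r * \<rho> * of_real q ^ Suc j :: complex) \<le> 2 * \<bar>c\<bar> + \<bar>r\<bar> * (norm \<rho> * \<bar>q\<bar> ^ Suc j)"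
      by (rule order.trans[OF norm_triangle_ineq]) (simp add: norm_mult norm_power)
    also have "\<dots> \<le> 2 * \<bar>c\<bar> + \<bar>r\<bar> * 1"
      using assms q1 by (intro add_left_mono mult_left_mono mult_le_one power_le_one) auto
    finally have A: "norm (2 * of_real c + of_real r * \<rho> * of_real q ^ Suc j :: complex) \<le> 2 * \<bar>c\<bar> + \<bar>r\<bar>" by simp
    have "norm \<rho> * \<bar>q\<bar> ^ j * norm (2 * of_real c + of_real r * \<rho> * of_real q ^ Suc j :: complex)
        \<le> 1 * \<bar>q\<bar> ^ j * (2 * \<bar>c\<bar> + \<bar>r\<bar>)"
      using assms A by (intro mult_mono) auto
    then show ?thesis by (simp only: norm_mult norm_minus_cancel norm_power norm_of_real) (simp add: mult_ac)
  qed
  have "(1 - \<bar>q\<bar>)\<^sup>2 > 0" using q1 by simp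
  show ?thesis
    unfolding jost_coeff_def coeff_bound_def prod_norm[symmetric]
  proof (intro prod_mono conjI norm_ge_zero)
    fix j
    show "norm (- \<rho> * of_real q ^ j * (2 * of_real c + of_real r * \<rho> * of_real q ^ Suc j) / ((1 - of_real q ^ Suc j) * (1 - \<rho>\<^sup>2 * of_real q ^ Suc j)))
        \<le> (2 * \<bar>c\<bar> + \<bar>r\<bar>) / (1 - \<bar>q\<bar>)\<^sup>2 * \<bar>q\<bar> ^ j"
      using frac_le[OF _ n[of j] \<open>(1 - \<bar>q\<bar>)\<^sup>2 > 0\<close> denominator_ge[OF assms, of j]]
      by (simp only: norm_divide) simp
  qed
qed

lemma summable_coeff_bound: "summable coeff_bound"
proof -
  let ?K = "(2 * \<bar>c\<bar> + \<bar>r\<bar>) / (1 - \<bar>q\<bar>)\<^sup>2"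
  have nn: "coeff_bound m \<ge> 0" for m
    unfolding coeff_bound_def by (intro prod_nonneg) auto
  have "(\<lambda>m. ?K * \<bar>q\<bar> ^ m) \<longlonglongrightarrow> ?K * 0"
    using q1 by (intro tendsto_intros LIMSEQ_power_zero) auto
  then have "eventually (\<lambda>m. ?K * \<bar>q\<bar> ^ m < 1/2) sequentially"
    by (intro order_tendstoD(2)) auto
  then obtain N where N: "\<And>m. m \<ge> N \<Longrightarrow> ?K * \<bar>q\<bar> ^ m < 1/2"
    by (auto simp: eventually_sequentially)
  show ?thesis
  proof (rule summable_ratio_test[of "1/2" N])
    fix m assume "m \<ge> N"
    have "coeff_bound (Suc m) = ?K * \<bar>q\<bar> ^ m * coeff_bound m"
      by (simp add: coeff_bound_def)
    also have "\<dots> \<le> 1/2 * coeff_bound m"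
      using N[OF \<open>m \<ge> N\<close>] nn by (intro mult_right_mono) auto
    finally show "norm (coeff_bound (Suc m)) \<le> 1/2 * norm (coeff_bound m)"
      using nn by simp
  qed simp
qed

lemma norm_jost_term_le:
  assumes "norm \<rho> \<le> 1" "norm u \<le> 1"
  shows "norm (jost_coeff q c r \<rho> m * u ^ m) \<le> coeff_bound m"
proof -
  have "norm (jost_coeff q c r \<rho> m) * norm u ^ m \<le> coeff_bound m * 1"
    using norm_jost_coeff_le[OF assms(1), of m] assms(2)
    by (intro mult_mono power_le_one) (auto intro: order.trans[OF norm_ge_zero])
  then show ?thesis by (simp add: norm_mult norm_power)
qed

lemma jost_series_sums:
  assumes "norm \<rho> \<le> 1" "norm u \<le> 1"
  shows "(\<lambda>m. jost_coeff q c r \<rho> m * u ^ m) sums jost_series q c r \<rho> u"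
  unfolding jost_series_def
  by (intro summable_sums summable_comparison_test[OF _ summable_coeff_bound])
     (auto intro!: exI norm_jost_term_le assms)

lemma continuous_jost_series:
  assumes "norm u \<le> 1"
  shows "continuous_on (cball 0 1) (\<lambda>\<rho>. jost_series q c r \<rho> u)"
proof (rule uniform_limit_theorem)
  show "uniform_limit (cball 0 1) (\<lambda>n \<rho>. \<Sum>m<n. jost_coeff q c r \<rho> m * u ^ m)
      (\<lambda>\<rho>. jost_series q c r \<rho> u) sequentially"
    unfolding jost_series_def
    by (rule Weierstrass_m_test[OF _ summable_coeff_bound]) (simp add: norm_jost_term_le assms)
  show "\<forall>\<^sub>F n in sequentially. continuous_on (cball 0 1) (\<lambda>\<rho>. \<Sum>m<n. jost_coeff q c r \<rho> m * u ^ m)"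
    unfolding jost_coeff_def using denominator_nonzero
    by (intro always_eventually allI continuous_intros) auto
qed simp

text \<open>
Comparing coefficients of \<open>u ^ Suc m\<close>, the three terms with index \<open>Suc m\<close> combine to the factor
\<open>(1 - q ^ Suc m) * (1 - \<rho>\<^sup>2 * q ^ Suc m)\<close>, which is the denominator in \<open>jost_coeff\<close>.
\<close>

lemma jost_series_q_equation:
  assumes "norm \<rho> \<le> 1" "norm u \<le> 1"
  shows "(1 + \<rho>\<^sup>2) * jost_series q c r \<rho> (of_real q * u)
    = (1 + of_real r * of_real q * u) * \<rho>\<^sup>2 * jost_series q c r \<rho> (of_real q ^ 2 * u)
      + 2 * of_real c * \<rho> * u * jost_series q c r \<rho> (of_real q * u) + jost_series q c r \<rho> u"
proof -
  let ?S = "jost_series q c r \<rho>" and ?s = "jost_coeff q c r \<rho>" and ?q = "of_real q :: complex"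
  let ?r = "of_real r :: complex" and ?c = "of_real c :: complex"
  have nq: "norm (?q * u) \<le> 1" "norm (?q ^ 2 * u) \<le> 1"
    using assms q1 by (auto simp: norm_mult norm_power abs_square_le_1 intro!: mult_le_one)
  \<comment> \<open>The coefficient with index 0 is 1.\<close>
  have tail: "(\<lambda>m. ?s (Suc m) * v ^ Suc m) sums (?S v - 1)" if "norm v \<le> 1" for v
    unfolding sums_Suc_iff[of "\<lambda>m. ?s m * v ^ m"]
    using jost_series_sums[OF assms(1) that] by (simp add: jost_coeff_def[of _ _ _ _ 0])
  have rec: "?s (Suc m) * ((1 - ?q ^ Suc m) * (1 - \<rho>\<^sup>2 * ?q ^ Suc m))
      = - \<rho> * ?q ^ m * (2 * ?c + ?r * \<rho> * ?q ^ Suc m) * ?s m" for m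
    using denominator_nonzero[OF assms(1), of m]
    unfolding jost_coeff_def prod.lessThan_Suc
    by (simp only: times_divide_eq_left times_divide_eq_right mult_eq_0_iff nonzero_mult_div_cancel_right
        simp_thms) (simp only: mult.commute)
  have "(\<lambda>m. (1 + \<rho>\<^sup>2) * (?s (Suc m) * (?q * u) ^ Suc m)
     - \<rho>\<^sup>2 * (?s (Suc m) * (?q ^ 2 * u) ^ Suc m) - ?s (Suc m) * u ^ Suc m
     - ?r * ?q * u * \<rho>\<^sup>2 * (?s m * (?q ^ 2 * u) ^ m) - 2 * ?c * \<rho> * u * (?s m * (?q * u) ^ m))
    sums ((1 + \<rho>\<^sup>2) * (?S (?q * u) - 1) - \<rho>\<^sup>2 * (?S (?q ^ 2 * u) - 1) - (?S u - 1)
     - ?r * ?q * u * \<rho>\<^sup>2 * ?S (?q ^ 2 * u) - 2 * ?c * \<rho> * u * ?S (?q * u))"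
    by (intro sums_diff sums_mult tail jost_series_sums nq assms)
  also have "(\<lambda>m. (1 + \<rho>\<^sup>2) * (?s (Suc m) * (?q * u) ^ Suc m)
     - \<rho>\<^sup>2 * (?s (Suc m) * (?q ^ 2 * u) ^ Suc m) - ?s (Suc m) * u ^ Suc m
     - ?r * ?q * u * \<rho>\<^sup>2 * (?s m * (?q ^ 2 * u) ^ m) - 2 * ?c * \<rho> * u * (?s m * (?q * u) ^ m)) = (\<lambda>m. 0)"
  proof
    fix m
    have alg: "(1 + x) * (A * (Q * U)) - x * (A * (Q * Q * U)) - A * U = - (U * (A * ((1 - Q) * (1 - x * Q))))"
      for A Q U x :: complex by (simp add: algebra_simps)
    have alg2: "- (u * U * (- \<rho> * Q * (2 * ?c + ?r * \<rho> * (?q * Q)) * A))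
        = ?r * ?q * u * \<rho>\<^sup>2 * (A * (Q * Q * U)) + 2 * ?c * \<rho> * u * (A * (Q * U))" for A Q U
      by (simp add: algebra_simps power2_eq_square)
    have p: "(?q ^ 2 * u) ^ n = ?q ^ n * ?q ^ n * u ^ n" "(?q * u) ^ n = ?q ^ n * u ^ n" for n
      by (simp_all add: power_mult_distrib power2_eq_square)
    have "(1 + \<rho>\<^sup>2) * (?s (Suc m) * (?q * u) ^ Suc m)
     - \<rho>\<^sup>2 * (?s (Suc m) * (?q ^ 2 * u) ^ Suc m) - ?s (Suc m) * u ^ Suc m
     = - (u ^ Suc m * (?s (Suc m) * ((1 - ?q ^ Suc m) * (1 - \<rho>\<^sup>2 * ?q ^ Suc m))))"
      unfolding p by (rule alg)
    also have "\<dots> = ?r * ?q * u * \<rho>\<^sup>2 * (?s m * (?q ^ 2 * u) ^ m) + 2 * ?c * \<rho> * u * (?s m * (?q * u) ^ m)"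
      unfolding rec p unfolding power_Suc by (rule alg2)
    finally show "(1 + \<rho>\<^sup>2) * (?s (Suc m) * (?q * u) ^ Suc m)
     - \<rho>\<^sup>2 * (?s (Suc m) * (?q ^ 2 * u) ^ Suc m) - ?s (Suc m) * u ^ Suc m
     - ?r * ?q * u * \<rho>\<^sup>2 * (?s m * (?q ^ 2 * u) ^ m) - 2 * ?c * \<rho> * u * (?s m * (?q * u) ^ m) = 0"
      by (simp only: add_diff_cancel_left' diff_self)
  qed
  finally have "(1 + \<rho>\<^sup>2) * (?S (?q * u) - 1) - \<rho>\<^sup>2 * (?S (?q ^ 2 * u) - 1) - (?S u - 1)
     - ?r * ?q * u * \<rho>\<^sup>2 * ?S (?q ^ 2 * u) - 2 * ?c * \<rho> * u * ?S (?q * u) = 0"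
    by (rule sums_unique2) (rule sums_zero)
  then show ?thesis by (simp add: algebra_simps)
qed

lemma jost_solves_rec:
  assumes "norm \<rho> \<le> 1" "\<rho> \<noteq> 0"
  shows "solves_rec q c r (\<rho> + 1 / \<rho>) (jost q c r \<rho>)"
  unfolding solves_rec_def
proof
  fix n
  let ?S = "\<lambda>k. jost_series q c r \<rho> (of_real q ^ k)"
  have "norm (of_real q ^ n :: complex) \<le> 1"
    using q1 by (auto simp: norm_power intro!: power_le_one)
  from jost_series_q_equation[OF assms(1) this]
  have "(1 + \<rho>\<^sup>2) * ?S (Suc n) = (1 + of_real r * of_real q ^ Suc n) * \<rho>\<^sup>2 * ?S (Suc (Suc n))
      + 2 * of_real c * \<rho> * of_real q ^ n * ?S (Suc n) + ?S n"
    by (simp add: power2_eq_square mult_ac)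
  then have "\<rho> ^ n * ((1 + \<rho>\<^sup>2) * ?S (Suc n)) = \<rho> ^ n * ((1 + of_real r * of_real q ^ Suc n) * \<rho>\<^sup>2 * ?S (Suc (Suc n))
      + 2 * of_real c * \<rho> * of_real q ^ n * ?S (Suc n) + ?S n)" by simp
  moreover have "(\<rho> + 1 / \<rho>) * (\<rho> ^ Suc n * ?S (Suc n)) = \<rho> ^ n * ((1 + \<rho>\<^sup>2) * ?S (Suc n))"
    using assms(2) by (simp add: field_simps power2_eq_square)
  ultimately show "(\<rho> + 1 / \<rho>) * jost q c r \<rho> (Suc n) =
     (1 + of_real r * of_real q ^ Suc n) * jost q c r \<rho> (Suc (Suc n))
       + 2 * of_real c * of_real q ^ n * jost q c r \<rho> (Suc n) + jost q c r \<rho> n"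
    unfolding jost_def by (simp add: algebra_simps power2_eq_square)
qed

lemma jost_series_limit:
  assumes "norm \<rho> \<le> 1"
  shows "(\<lambda>n. jost_series q c r \<rho> (of_real q ^ n)) \<longlonglongrightarrow> 1"
proof -
  have u: "uniform_limit (cball 0 1) (\<lambda>n u. \<Sum>m<n. jost_coeff q c r \<rho> m * u ^ m)
      (\<lambda>u. jost_series q c r \<rho> u) sequentially"
    unfolding jost_series_def
    by (rule Weierstrass_m_test[OF _ summable_coeff_bound]) (simp add: norm_jost_term_le assms)
  have "continuous_on (cball 0 1) (jost_series q c r \<rho>)"
    by (rule uniform_limit_theorem[OF _ u]) (auto intro!: always_eventually continuous_intros)
  then have "isCont (jost_series q c r \<rho>) 0"
    by (rule continuous_on_interior) simp
  moreover have "(\<lambda>n. of_real q ^ n :: complex) \<longlonglongrightarrow> 0"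
    using q1 by (intro LIMSEQ_power_zero) simp
  ultimately have "(\<lambda>n. jost_series q c r \<rho> (of_real q ^ n)) \<longlonglongrightarrow> jost_series q c r \<rho> 0"
    by (rule isCont_tendsto_compose)
  also have "jost_series q c r \<rho> 0 = 1"
    unfolding jost_series_def using suminf_finite[of "{0}" "\<lambda>m. jost_coeff q c r \<rho> m * 0 ^ m"]
    by (simp add: jost_coeff_def)
  finally show ?thesis .
qed

lemma cnj_jost: 
  assumes "norm \<rho> \<le> 1"
  shows "jost q c r (cnj \<rho>) n = cnj (jost q c r \<rho> n)"
proof -
  have "norm (of_real q ^ n :: complex) \<le> 1"
    using q1 by (auto simp: norm_power intro!: power_le_one)
  from jost_series_sums[OF assms this]
  have "(\<lambda>m. cnj (jost_coeff q c r \<rho> m * (of_real q ^ n) ^ m)) sums cnj (jost_series q c r \<rho> (of_real q ^ n))"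
    by (simp only: sums_cnj)
  moreover have "cnj (jost_coeff q c r \<rho> m * (of_real q ^ n) ^ m) = jost_coeff q c r (cnj \<rho>) m * (of_real q ^ n) ^ m" for m
    by (simp add: jost_coeff_def)
  ultimately have "(\<lambda>m. jost_coeff q c r (cnj \<rho>) m * (of_real q ^ n) ^ m) sums cnj (jost_series q c r \<rho> (of_real q ^ n))"
    by (simp only:)
  then have "jost_series q c r (cnj \<rho>) (of_real q ^ n) = cnj (jost_series q c r \<rho> (of_real q ^ n))"
    unfolding jost_series_def[of _ _ _ "cnj \<rho>"] by (rule sums_unique[symmetric])
  then show ?thesis by (simp add: jost_def)
qed

text \<open>
On the unit circle \<open>cnj \<rho> = 1 / \<rho>\<close>, so both Jost solutions solve the same recurrence. As \<open>n\<close> grows,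
the powers \<open>\<rho> ^ n\<close> and \<open>cnj \<rho> ^ n\<close> cancel in the Wronskian, which tends to \<open>\<rho> - cnj \<rho>\<close>.
\<close>

lemma jost_wronskian:
  assumes "\<And>k::nat. k \<ge> 1 \<Longrightarrow> 1 + r * q ^ k > 0" and "norm \<rho> = 1"
  shows "jost q c r \<rho> 1 * jost q c r (cnj \<rho>) 0 - jost q c r \<rho> 0 * jost q c r (cnj \<rho>) 1
     = of_real (qpoch_inf (- (r * q)) q) * (\<rho> - cnj \<rho>)"
proof -
  have c1: "norm (cnj \<rho>) = 1" "norm \<rho> \<le> 1" "norm (cnj \<rho>) \<le> 1" and nz: "\<rho> \<noteq> 0" "cnj \<rho> \<noteq> 0" using assms(2) by auto
  have m1: "\<rho> * cnj \<rho> = 1"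
    using assms(2) complex_norm_square[of \<rho>] by simp
  then have m2: "1 / \<rho> = cnj \<rho>" "1 / cnj \<rho> = \<rho>" using nz by (auto simp: field_simps)
  let ?S = "\<lambda>\<rho> k. jost_series q c r \<rho> (of_real q ^ k)"
  have W: "jost q c r \<rho> (Suc n) * jost q c r (cnj \<rho>) n - jost q c r \<rho> n * jost q c r (cnj \<rho>) (Suc n)
     = \<rho> * ?S \<rho> (Suc n) * ?S (cnj \<rho>) n - cnj \<rho> * ?S \<rho> n * ?S (cnj \<rho>) (Suc n)" for n
  proof -
    have "\<rho> ^ n * cnj \<rho> ^ n = 1" using m1 by (simp add: power_mult_distrib[symmetric])
    moreover have "\<rho> ^ Suc n * a * (cnj \<rho> ^ n * b) - \<rho> ^ n * d * (cnj \<rho> ^ Suc n * e)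
        = (\<rho> ^ n * cnj \<rho> ^ n) * (\<rho> * a * b - cnj \<rho> * d * e)" for a b d e
      by (simp add: algebra_simps)
    ultimately show ?thesis unfolding jost_def by simp
  qed
  have "(\<lambda>n. of_real (weight_prod q r n) * (\<rho> * ?S \<rho> (Suc n) * ?S (cnj \<rho>) n - cnj \<rho> * ?S \<rho> n * ?S (cnj \<rho>) (Suc n)))
     \<longlonglongrightarrow> of_real (qpoch_inf (- (r * q)) q) * (\<rho> * 1 * 1 - cnj \<rho> * 1 * 1)"
    by (intro tendsto_intros weight_prod_limit assms jost_series_limit c1
          LIMSEQ_Suc[OF jost_series_limit])
  moreover have "of_real (weight_prod q r n) * (\<rho> * ?S \<rho> (Suc n) * ?S (cnj \<rho>) n - cnj \<rho> * ?S \<rho> n * ?S (cnj \<rho>) (Suc n))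
     = jost q c r \<rho> 1 * jost q c r (cnj \<rho>) 0 - jost q c r \<rho> 0 * jost q c r (cnj \<rho>) 1" for n
    unfolding W[symmetric]
    using jost_solves_rec[OF c1(2) nz(1)] jost_solves_rec[OF c1(3) nz(2)]
    by (intro wronskian_const[where s = "\<rho> + cnj \<rho>"]) (simp_all add: m2 add.commute)
  ultimately show ?thesis by (simp add: LIMSEQ_const_iff)
qed

text \<open>
The Jost solution tends to zero, so its Wronskian with a bounded solution tends to zero; being
constant up to the convergent factor \<open>weight_prod\<close>, it vanishes identically. If \<open>jost \<dots> 0\<close> were
zero, then \<open>jost \<dots> 1\<close> and, by the recurrence, the whole Jost solution would be zero, which
contradicts \<open>jost_series_limit\<close>.
\<close>

lemma bounded_solution_ratio:
  assumes pos: "\<And>k::nat. k \<ge> 1 \<Longrightarrow> 1 + r * q ^ k > 0"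
    and \<rho>: "norm \<rho> < 1" "\<rho> \<noteq> 0"
    and u: "solves_rec q c r (\<rho> + 1 / \<rho>) u" "u 0 \<noteq> 0" "\<And>n. norm (u n) \<le> B"
  shows "jost q c r \<rho> 0 \<noteq> 0" "u 1 = u 0 * (jost q c r \<rho> 1 / jost q c r \<rho> 0)"
proof -
  have \<rho>1: "norm \<rho> \<le> 1" using \<rho> by simp
  let ?J = "jost q c r \<rho>"
  note J = jost_solves_rec[OF \<rho>1 \<rho>(2)]
  have "(\<lambda>n. \<rho> ^ n * jost_series q c r \<rho> (of_real q ^ n)) \<longlonglongrightarrow> 0 * 1"
    using \<rho> by (intro tendsto_mult jost_series_limit LIMSEQ_power_zero) auto
  then have J0: "?J \<longlonglongrightarrow> 0" by (simp add: jost_def[abs_def])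
  have bu: "Bfun u sequentially" "Bfun (\<lambda>n. u (Suc n)) sequentially"
    using u(3) by (auto intro!: BfunI always_eventually)
  have "(\<lambda>n. u (Suc n) * ?J n - u n * ?J (Suc n)) \<longlonglongrightarrow> 0 - 0"
    by (intro tendsto_diff; rule tendsto_Zfun_iff[THEN iffD2]; simp;
        intro bounded_bilinear.Bfun_prod_Zfun[OF bounded_bilinear_mult] bu)
       (use J0 LIMSEQ_Suc[OF J0] in \<open>simp_all add: tendsto_Zfun_iff\<close>)
  then have "(\<lambda>n. of_real (weight_prod q r n) * (u (Suc n) * ?J n - u n * ?J (Suc n)))
      \<longlonglongrightarrow> of_real (qpoch_inf (- (r * q)) q) * (0 - 0)"
    by (intro tendsto_mult tendsto_of_real weight_prod_limit pos)
  then have "(\<lambda>n. u 1 * ?J 0 - u 0 * ?J 1) \<longlonglongrightarrow> 0"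
    unfolding wronskian_const[OF u(1) J] by simp
  then have eq: "u 1 * ?J 0 = u 0 * ?J 1" by (simp add: LIMSEQ_const_iff)
  show nz: "?J 0 \<noteq> 0"
  proof
    assume "?J 0 = 0"
    then have "?J 1 = 0" using eq u(2) by simp
    have "?J n = 0 \<and> ?J (Suc n) = 0" for n
    proof (induction n)
      case (Suc n)
      have "1 + r * q ^ Suc n \<noteq> 0" using pos[of "Suc n"] by linarith
      then have "1 + of_real r * of_real q ^ Suc n \<noteq> (0::complex)"
        by (metis of_real_1 of_real_add of_real_mult of_real_power of_real_eq_0_iff)
      then show ?case using J Suc unfolding solves_rec_def
        by (metis add_0 add_0_right mult_eq_0_iff)
    qed (use \<open>?J 0 = 0\<close> \<open>?J 1 = 0\<close> in simp)
    then have "(\<lambda>n. jost_series q c r \<rho> (of_real q ^ n)) = (\<lambda>n. 0)"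
      using \<rho>(2) by (auto simp: jost_def)
    with jost_series_limit[OF \<rho>1] show False by (simp add: LIMSEQ_const_iff)
  qed
  show "u 1 = u 0 * (?J 1 / ?J 0)" using eq nz by (simp add: field_simps)
qed

end

section \<open>Stieltjes inversion and Lebesgue decomposition\<close>

definition cauchy_transform :: "real measure \<Rightarrow> complex \<Rightarrow> complex" where
  "cauchy_transform M z = (\<integral>t. 1 / (of_real t - z) \<partial>M)"

lemma norm_resolvent_le:
  assumes "0 < Im z"
  shows "norm (1 / (of_real t - z)) \<le> 1 / Im z"
proof -
  have "Im z \<le> norm (of_real t - z)"
    using abs_Im_le_cmod[of "of_real t - z"] by simp
  then show ?thesis using assms by (simp add: norm_divide frac_le)
qed

lemma resolvent_measurable:
  "(\<lambda>t. 1 / (complex_of_real t - z)) \<in> borel_measurable borel"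
  by measurable

lemma integrable_resolvent:
  assumes "finite_measure M" "sets M = sets borel" "0 < Im z"
  shows "integrable M (\<lambda>t. 1 / (complex_of_real t - z))"
proof -
  interpret finite_measure M by fact
  have "(\<lambda>t. 1 / (complex_of_real t - z)) \<in> borel_measurable M"
    using resolvent_measurable measurable_cong_sets[OF assms(2) refl] by blast
  then show ?thesis
    by (intro integrable_const_bound[where B="1 / Im z"]) (simp_all add: norm_resolvent_le assms del: norm_divide)
qed

lemma Im_resolvent:
  "Im (1 / (of_real t - Complex x e)) = e / ((t - x)\<^sup>2 + e\<^sup>2)"
  by (simp add: Im_divide power2_eq_square)

text \<open>
On a horizontal line the imaginary part is \<open>\<pi>\<close> times the Poisson integral of the measure. The form with the
nonnegative integral is what Tonelli's theorem needs below.
\<close>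

lemma Im_cauchy_transform:
  assumes "finite_measure M" "sets M = sets borel" "0 < e"
  shows "ennreal (Im (cauchy_transform M (Complex x e))) = (\<integral>\<^sup>+t. ennreal (e / ((t - x)\<^sup>2 + e\<^sup>2)) \<partial>M)"
    and "0 \<le> Im (cauchy_transform M (Complex x e))"
proof -
  have i: "integrable M (\<lambda>t. 1 / (complex_of_real t - Complex x e))"
    using integrable_resolvent[OF assms(1,2)] assms(3) by simp
  have eq: "Im (cauchy_transform M (Complex x e)) = (\<integral>t. e / ((t - x)\<^sup>2 + e\<^sup>2) \<partial>M)"
    unfolding cauchy_transform_def integral_Im[OF i, symmetric] Im_resolvent ..
  have "integrable M (\<lambda>t. e / ((t - x)\<^sup>2 + e\<^sup>2))"
    using integrable_Im[OF i] unfolding Im_resolvent .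
  then show "ennreal (Im (cauchy_transform M (Complex x e))) = (\<integral>\<^sup>+t. ennreal (e / ((t - x)\<^sup>2 + e\<^sup>2)) \<partial>M)"
    unfolding eq using assms(3) by (subst nn_integral_eq_integral) auto
  show "0 \<le> Im (cauchy_transform M (Complex x e))"
    unfolding eq using assms(3) by (intro Bochner_Integration.integral_nonneg) auto
qed

lemma poisson_kernel_integral:
  assumes "0 < e" "a \<le> b"
  shows "(\<integral>\<^sup>+x. ennreal (e / ((t - x)\<^sup>2 + e\<^sup>2)) * indicator {a..b} x \<partial>lborel)
     = ennreal (arctan ((b - t) / e) - arctan ((a - t) / e))"
proof (rule nn_integral_FTC_Icc[where F="\<lambda>x. arctan ((x - t) / e)"])
  fix x assume "x \<in> {a..b}"
  have p: "0 < (t - x)\<^sup>2 + e\<^sup>2" using assms by (intro add_nonneg_pos) auto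
  have "((\<lambda>x. arctan ((x - t) / e)) has_field_derivative (1 / (1 + ((x - t) / e)\<^sup>2)) * (1 / e)) (at x)"
    using assms by (auto intro!: derivative_eq_intros simp: divide_simps)
  also have "(1 / (1 + ((x - t) / e)\<^sup>2)) * (1 / e) = e / ((t - x)\<^sup>2 + e\<^sup>2)"
  proof -
    have "1 + ((x - t) / e)\<^sup>2 = ((t - x)\<^sup>2 + e\<^sup>2) / e\<^sup>2"
      using assms by (simp add: power_divide divide_simps power2_commute)
    then show ?thesis using assms p by (simp add: power2_eq_square)
  qed
  finally show "((\<lambda>x. arctan ((x - t) / e)) has_field_derivative e / ((t - x)\<^sup>2 + e\<^sup>2)) (at x)" .
qed (use assms in auto)

lemma integral_Im_cauchy_transform:
  assumes "finite_measure M" "sets M = sets borel" "0 < e" "a \<le> b"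
  shows "(\<integral>\<^sup>+t. ennreal (arctan ((b - t) / e) - arctan ((a - t) / e)) \<partial>M)
    = (\<integral>\<^sup>+x. ennreal (Im (cauchy_transform M (Complex x e))) * indicator {a..b} x \<partial>lborel)"
proof -
  interpret finite_measure M by fact
  interpret pair_sigma_finite M lborel ..
  have sets: "sets (M \<Otimes>\<^sub>M lborel) = sets (borel \<Otimes>\<^sub>M borel)"
    by (intro sets_pair_measure_cong assms) simp
  have m: "(\<lambda>(t, x). ennreal (e / ((t - x)\<^sup>2 + e\<^sup>2)) * indicator {a..b} x) \<in> borel_measurable (M \<Otimes>\<^sub>M lborel)"
    unfolding measurable_cong_sets[OF sets refl] by measurable
  have "(\<integral>\<^sup>+t. ennreal (arctan ((b - t) / e) - arctan ((a - t) / e)) \<partial>M)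
     = (\<integral>\<^sup>+t. (\<integral>\<^sup>+x. ennreal (e / ((t - x)\<^sup>2 + e\<^sup>2)) * indicator {a..b} x \<partial>lborel) \<partial>M)"
    by (simp only: poisson_kernel_integral[OF assms(3,4)])
  also have "\<dots> = (\<integral>\<^sup>+x. (\<integral>\<^sup>+t. ennreal (e / ((t - x)\<^sup>2 + e\<^sup>2)) * indicator {a..b} x \<partial>M) \<partial>lborel)"
    using Fubini'[OF m] by simp
  also have "\<dots> = (\<integral>\<^sup>+x. ennreal (Im (cauchy_transform M (Complex x e))) * indicator {a..b} x \<partial>lborel)"
    unfolding Im_cauchy_transform(1)[OF assms(1-3)]
  proof (intro nn_integral_cong nn_integral_multc)
    fix x
    show "(\<lambda>t. ennreal (e / ((t - x)\<^sup>2 + e\<^sup>2))) \<in> borel_measurable M"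
      unfolding measurable_cong_sets[OF assms(2) refl] by measurable
  qed
  finally show ?thesis .
qed

lemma arctan_scaled_limit:
  "(\<lambda>n. arctan (y / inverse (real (Suc n)))) \<longlonglongrightarrow> pi / 2 * sgn y"
proof -
  have top: "filterlim (\<lambda>n. y * real (Suc n)) at_top sequentially" if "0 < y" for y :: real
    using that
    by (intro filterlim_tendsto_pos_mult_at_top[OF tendsto_const]
        filterlim_compose[OF filterlim_real_sequentially filterlim_Suc])
  consider "y = 0" | "0 < y" | "y < 0" by linarith
  then show ?thesis
  proof cases
    case 2
    then show ?thesis
      using filterlim_compose[OF tendsto_arctan_at_top top[OF 2]] by (simp add: field_simps)
  next
    case 3
    have "(\<lambda>n. arctan (- y * real (Suc n))) \<longlonglongrightarrow> pi / 2"
      using filterlim_compose[OF tendsto_arctan_at_top top[of "- y"]] 3 by simp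
    then have "(\<lambda>n. - arctan (- (y * real (Suc n)))) \<longlonglongrightarrow> - (pi / 2)"
      by (intro tendsto_minus) (simp only: mult_minus_left)
    then show ?thesis using 3 by (simp only: arctan_minus minus_minus) (simp add: field_simps)
  qed simp
qed

text \<open>
Integrating the Poisson kernel over \<open>{a..b}\<close> gives a difference of arctangents, which converges to \<open>\<pi>\<close>
times the indicator of the interval, with \<open>\<pi> / 2\<close> at the two endpoints. Because of the endpoints only
the open interval bounds the limit from below and the closed one from above.
\<close>

lemma stieltjes_inversion_Icc:
  assumes M: "finite_measure M" "sets M = sets borel" and "a \<le> b"
    and lim: "\<And>x. x \<in> {a..b} \<Longrightarrow> (\<lambda>n. Im (cauchy_transform M (Complex x (inverse (real (Suc n)))))) \<longlonglongrightarrow> pi * w x"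
    and bound: "\<And>x n. x \<in> {a..b} \<Longrightarrow> Im (cauchy_transform M (Complex x (inverse (real (Suc n))))) \<le> B"
    and w: "w \<in> borel_measurable borel"
  shows "emeasure M {a<..<b} \<le> (\<integral>\<^sup>+x\<in>{a..b}. ennreal (w x) \<partial>lborel)"
    and "(\<integral>\<^sup>+x\<in>{a..b}. ennreal (w x) \<partial>lborel) \<le> emeasure M {a..b}"
proof -
  interpret finite_measure M by fact
  note w [measurable]
  let ?e = "\<lambda>n. inverse (real (Suc n))"
  let ?L = "\<lambda>t. pi / 2 * sgn (b - t) - pi / 2 * sgn (a - t)"
  let ?u = "\<lambda>n x. Im (cauchy_transform M (Complex x (?e n)))"
  have mM: "f \<in> borel_measurable M" if "f \<in> borel_measurable borel" for f :: "real \<Rightarrow> ennreal"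
    using that unfolding measurable_cong_sets[OF M(2) refl] .
  have "(\<lambda>n. \<integral>\<^sup>+t. ennreal (arctan ((b - t) / ?e n) - arctan ((a - t) / ?e n)) \<partial>M)
     \<longlonglongrightarrow> (\<integral>\<^sup>+t. ennreal (?L t) \<partial>M)"
  proof (rule nn_integral_dominated_convergence[where w="\<lambda>_. ennreal pi"])
    fix n
    show "(\<lambda>t. ennreal (arctan ((b - t) / ?e n) - arctan ((a - t) / ?e n))) \<in> borel_measurable M"
      by (rule mM) measurable
    have "arctan ((b - t) / ?e n) - arctan ((a - t) / ?e n) \<le> pi" for t
      using arctan_bounded[of "(b - t) / ?e n"] arctan_bounded[of "(a - t) / ?e n"] by simp
    then show "AE t in M. ennreal (arctan ((b - t) / ?e n) - arctan ((a - t) / ?e n)) \<le> ennreal pi"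
      by (simp add: ennreal_leI del: inverse_eq_divide divide_inverse)
  next
    show "(\<integral>\<^sup>+ t. ennreal pi \<partial>M) < \<infinity>"
      by (simp add: emeasure_eq_measure ennreal_mult_less_top)
    show "AE t in M. (\<lambda>n. ennreal (arctan ((b - t) / ?e n) - arctan ((a - t) / ?e n))) \<longlonglongrightarrow> ennreal (?L t)"
      by (intro AE_I2 tendsto_ennrealI tendsto_diff arctan_scaled_limit)
  qed (rule mM, measurable)
  moreover have "(\<lambda>n. \<integral>\<^sup>+x. ennreal (?u n x) * indicator {a..b} x \<partial>lborel)
     \<longlonglongrightarrow> (\<integral>\<^sup>+x. ennreal (pi * w x) * indicator {a..b} x \<partial>lborel)"
  proof (rule nn_integral_dominated_convergence[where w="\<lambda>x. ennreal B * indicator {a..b} x"])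
    fix n
    have "(\<lambda>p. ennreal (?e n / ((snd p - fst p)\<^sup>2 + (?e n)\<^sup>2))) \<in> borel_measurable (lborel \<Otimes>\<^sub>M M)"
      unfolding measurable_cong_sets[OF sets_pair_measure_cong[OF sets_lborel M(2)] refl] by measurable
    from borel_measurable_nn_integral_fst[OF this]
    have "(\<lambda>x. ennreal (?u n x)) \<in> borel_measurable lborel"
      unfolding Im_cauchy_transform(1)[OF M inverse_positive_iff_positive[THEN iffD2, OF of_nat_0_less_iff[THEN iffD2, OF zero_less_Suc]]]
      by simp
    then show "(\<lambda>x. ennreal (?u n x) * indicator {a..b} x) \<in> borel_measurable lborel"
      by measurable
    show "AE x in lborel. ennreal (?u n x) * indicator {a..b} x \<le> ennreal B * indicator {a..b} x"
      using bound[of _ n] by (intro AE_I2) (auto split: split_indicator intro: ennreal_leI simp del: of_nat_Suc)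
  next
    show "(\<integral>\<^sup>+ x. ennreal B * indicator {a..b} x \<partial>lborel) < \<infinity>"
      using \<open>a \<le> b\<close> by (simp add: nn_integral_cmult_indicator ennreal_mult_less_top)
    show "AE x in lborel. (\<lambda>n. ennreal (?u n x) * indicator {a..b} x) \<longlonglongrightarrow> ennreal (pi * w x) * indicator {a..b} x"
      using lim by (intro AE_I2) (auto split: split_indicator intro!: tendsto_ennrealI simp del: of_nat_Suc)
  qed (use w in measurable)
  ultimately have "(\<integral>\<^sup>+t. ennreal (?L t) \<partial>M) = (\<integral>\<^sup>+x. ennreal (pi * w x) * indicator {a..b} x \<partial>lborel)"
    using integral_Im_cauchy_transform[OF M _ \<open>a \<le> b\<close>, of "?e _"]
    by (simp del: of_nat_Suc divide_inverse) (rule LIMSEQ_unique)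
  also have "\<dots> = (\<integral>\<^sup>+x. ennreal pi * (ennreal (w x) * indicator {a..b} x) \<partial>lborel)"
    by (simp add: ennreal_mult' mult.assoc)
  also have "\<dots> = ennreal pi * (\<integral>\<^sup>+x\<in>{a..b}. ennreal (w x) \<partial>lborel)"
    by (intro nn_integral_cmult) measurable
  finally have eq: "(\<integral>\<^sup>+t. ennreal (?L t) \<partial>M) = ennreal pi * (\<integral>\<^sup>+x\<in>{a..b}. ennreal (w x) \<partial>lborel)" .
  have cancel: "x \<le> y" if "ennreal pi * x \<le> ennreal pi * y" for x y
    using that by (simp add: ennreal_mult_le_mult_iff)
  have ind: "(\<integral>\<^sup>+t. ennreal pi * indicator A t \<partial>M) = ennreal pi * emeasure M A" if "A \<in> sets borel" for A
    using that M(2) by (intro nn_integral_cmult_indicator) simp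
  have "(\<integral>\<^sup>+t. ennreal pi * indicator {a<..<b} t \<partial>M) \<le> (\<integral>\<^sup>+t. ennreal (?L t) \<partial>M)"
  proof (rule nn_integral_mono)
    fix t
    show "ennreal pi * indicator {a<..<b} t \<le> ennreal (?L t)"
    proof (cases "t \<in> {a<..<b}")
      case True
      then have "?L t = pi" by (simp only: greaterThanLessThan_iff sgn_if) simp
      then show ?thesis using True by (simp only: indicator_simps mult_1_right order_refl)
    next
      case False
      then show ?thesis by (simp add: indicator_simps(2)[OF False])
    qed
  qed
  then show "emeasure M {a<..<b} \<le> (\<integral>\<^sup>+x\<in>{a..b}. ennreal (w x) \<partial>lborel)"
    unfolding eq ind[OF borel_open[OF open_greaterThanLessThan]] by (rule cancel)
  have "(\<integral>\<^sup>+t. ennreal (?L t) \<partial>M) \<le> (\<integral>\<^sup>+t. ennreal pi * indicator {a..b} t \<partial>M)"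
  proof (rule nn_integral_mono)
    fix t
    show "ennreal (?L t) \<le> ennreal pi * indicator {a..b} t"
    proof (cases "t \<in> {a..b}")
      case True
      have "?L t \<le> pi" using pi_gt_zero by (auto simp: sgn_if simp del: pi_gt_zero)
      then show ?thesis using True by (simp only: indicator_simps mult_1_right ennreal_leI)
    next
      case False
      then have "sgn (b - t) = sgn (a - t)" using \<open>a \<le> b\<close> by (auto simp: sgn_if)
      then have "?L t = 0" by (simp only: diff_self)
      then show ?thesis by simp
    qed
  qed
  then show "(\<integral>\<^sup>+x\<in>{a..b}. ennreal (w x) \<partial>lborel) \<le> emeasure M {a..b}"
    unfolding eq ind[OF borel_closed[OF closed_atLeastAtMost]] by (rule cancel)
qed

text \<open>
The two one-sided bounds suffice: a closed interval lies in slightly larger open ones, whose measure is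
at most the integral over their closures, and these integrals shrink to the integral over the interval.
So endpoints carry no mass. Equality on compact intervals then determines the measure.
\<close>

lemma stieltjes_inversion:
  assumes M: "finite_measure M" "sets M = sets borel"
    and lim: "\<And>x. x \<in> {l<..<u} \<Longrightarrow> (\<lambda>n. Im (cauchy_transform M (Complex x (inverse (real (Suc n)))))) \<longlonglongrightarrow> pi * w x"
    and bound: "\<And>a b. l < a \<Longrightarrow> b < u \<Longrightarrow> \<exists>B. \<forall>x\<in>{a..b}. \<forall>n. Im (cauchy_transform M (Complex x (inverse (real (Suc n))))) \<le> B"
    and w: "set_borel_measurable lborel {l<..<u} w"
    and A: "A \<in> sets borel" "A \<subseteq> {l<..<u}"
  shows "emeasure M A = (\<integral>\<^sup>+x\<in>A. ennreal (w x) \<partial>lborel)"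
proof -
  interpret finite_measure M by fact
  \<comment> \<open>Only the values of \<open>w\<close> on the interval are known to be measurable.\<close>
  define v where "v x = indicator {l<..<u} x * w x" for x
  have v: "v \<in> borel_measurable borel"
    using w unfolding set_borel_measurable_def v_def[abs_def] by simp
  define N where "N = density lborel (\<lambda>x. ennreal (v x))"
  have emN: "emeasure N B = (\<integral>\<^sup>+x\<in>B. ennreal (v x) \<partial>lborel)" if "B \<in> sets borel" for B
    unfolding N_def using that v by (intro emeasure_density) auto
  have setsN: "sets N = sets borel" by (simp add: N_def)
  have two: "emeasure M {a<..<b} \<le> emeasure N {a..b}" "emeasure N {a..b} \<le> emeasure M {a..b}"
    if ab: "l < a" "b < u" "a \<le> b" for a b
  proof -
    obtain B where B: "\<forall>x\<in>{a..b}. \<forall>n. Im (cauchy_transform M (Complex x (inverse (real (Suc n))))) \<le> B"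
      using bound[OF ab(1,2)] by blast
    have *: "(\<lambda>n. Im (cauchy_transform M (Complex x (inverse (real (Suc n)))))) \<longlonglongrightarrow> pi * v x" if "x \<in> {a..b}" for x
      using lim[of x] that ab by (simp add: v_def)
    note st = stieltjes_inversion_Icc[OF M ab(3) * _ v, of B]
    show "emeasure M {a<..<b} \<le> emeasure N {a..b}" "emeasure N {a..b} \<le> emeasure M {a..b}"
      using st B by (simp_all add: emN)
  qed
  have Icc: "emeasure M {a..b} = emeasure N {a..b}" if ab: "l < a" "b < u" for a b
  proof (cases "a \<le> b")
    case True
    define d where "d = min (a - l) (u - b)"
    have d: "0 < d" using ab by (simp add: d_def)
    define r where "r n = d / real (n + 2)" for n
    have r: "0 < r n" "r n < d" for n using d by (simp_all add: r_def field_simps add_pos_nonneg)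
    have rdec: "r n \<le> r m" if "m \<le> n" for m n
      unfolding r_def using d that by (intro divide_left_mono) auto
    have rlim: "r \<longlonglongrightarrow> 0"
      unfolding r_def using LIMSEQ_ignore_initial_segment[OF lim_const_over_n[of d], of 2] by simp
    have lu: "l < a - r n" "b + r n < u" for n
      using r(2)[of n] by (auto simp: d_def)
    have "emeasure M {a..b} \<le> emeasure N {a - r n..b + r n}" for n
    proof -
      have "emeasure M {a..b} \<le> emeasure M {a - r n<..<b + r n}"
        using r(1)[of n] M(2) by (intro emeasure_mono) auto
      also have "\<dots> \<le> emeasure N {a - r n..b + r n}"
        using two[OF lu] True r(1)[of n] by simp
      finally show ?thesis .
    qed
    moreover have "(\<lambda>n. emeasure N {a - r n..b + r n}) \<longlonglongrightarrow> emeasure N (\<Inter>n. {a - r n..b + r n})"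
    proof (rule Lim_emeasure_decseq)
      show "decseq (\<lambda>n. {a - r n..b + r n})"
        unfolding decseq_def
      proof (intro allI impI)
        fix m n :: nat assume "m \<le> n"
        from rdec[OF this] show "{a - r n..b + r n} \<subseteq> {a - r m..b + r m}" by auto
      qed
      show "emeasure N {a - r n..b + r n} \<noteq> \<infinity>" for n
        using two(2)[OF lu, of n n] True r(1)[of n] emeasure_finite[of "{a - r n..b + r n}"]
        by (auto simp: top_unique)
    qed (auto simp: setsN)
    moreover have "(\<Inter>n. {a - r n..b + r n}) = {a..b}"
    proof safe
      fix x assume x: "x \<in> (\<Inter>n. {a - r n..b + r n})"
      have "(\<lambda>n. a - r n) \<longlonglongrightarrow> a - 0" "(\<lambda>n. b + r n) \<longlonglongrightarrow> b + 0"
        by (intro tendsto_intros rlim)+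
      with x show "x \<in> {a..b}"
        by (auto intro: LIMSEQ_le_const LIMSEQ_le_const2)
    next
      fix x n assume "x \<in> {a..b}"
      with r(1)[of n] show "x \<in> {a - r n..b + r n}" by simp
    qed
    ultimately have "emeasure M {a..b} \<le> emeasure N {a..b}"
      by (auto intro!: LIMSEQ_le_const)
    then show ?thesis using two(2)[OF ab True] by simp
  qed simp
  define M' where "M' = density M (indicator {l<..<u})"
  have emM': "emeasure M' B = emeasure M (B \<inter> {l<..<u})" if "B \<in> sets borel" for B
    unfolding M'_def using that M(2)
    by (subst emeasure_restricted) (simp_all add: Int_commute)
  have emN': "emeasure N B = emeasure N (B \<inter> {l<..<u})" if "B \<in> sets borel" for B
    using that by (simp add: emN) (auto intro!: nn_integral_cong simp: v_def split: split_indicator)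
  have "M' = N"
  proof (rule measure_eqI_lessThan)
    show "sets M' = sets borel" "sets N = sets borel" using M(2) by (simp_all add: M'_def N_def)
    fix x
    show "emeasure M' {x<..} < \<infinity>"
      by (simp add: emM' emeasure_eq_measure)
    define p where "p = max x l"
    have I: "{x<..} \<inter> {l<..<u} = {p<..<u}" by (auto simp: p_def)
    have "emeasure M {p<..<u} = emeasure N {p<..<u}"
    proof -
      define K where "K n = {p + inverse (real (Suc n)) .. u - inverse (real (Suc n))}" for n
      have inc: "incseq K"
        unfolding K_def incseq_def
      proof (intro allI impI)
        fix m n :: nat assume "m \<le> n"
        then have "inverse (real (Suc n)) \<le> inverse (real (Suc m))" by (intro le_imp_inverse_le) auto
        then show "{p + inverse (real (Suc m))..u - inverse (real (Suc m))} \<subseteq> {p + inverse (real (Suc n))..u - inverse (real (Suc n))}"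
          by auto
      qed
      have un: "(\<Union>n. K n) = {p<..<u}"
      proof
        show "(\<Union>n. K n) \<subseteq> {p<..<u}"
        proof
          fix y assume "y \<in> (\<Union>n. K n)"
          then obtain n where "p + inverse (real (Suc n)) \<le> y" "y \<le> u - inverse (real (Suc n))"
            unfolding K_def by auto
          moreover have "0 < inverse (real (Suc n))" by simp
          ultimately have "p < y" "y < u" by linarith+
          then show "y \<in> {p<..<u}" by simp
        qed
        show "{p<..<u} \<subseteq> (\<Union>n. K n)"
        proof
          fix y assume "y \<in> {p<..<u}"
          then obtain n where "inverse (real (Suc n)) < min (y - p) (u - y)"
            using reals_Archimedean[of "min (y - p) (u - y)"] by auto
          then show "y \<in> (\<Union>n. K n)" unfolding K_def by (intro UN_I[of n]) auto
        qed
      qed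
      have K: "emeasure M (K n) = emeasure N (K n)" for n
      proof -
        have "0 < inverse (real (Suc n))" by simp
        moreover have "l \<le> p" by (simp add: p_def)
        ultimately have "l < p + inverse (real (Suc n))" "u - inverse (real (Suc n)) < u"
          by linarith+
        then show ?thesis unfolding K_def by (rule Icc)
      qed
      have "(SUP n. emeasure M (K n)) = emeasure M {p<..<u}" "(SUP n. emeasure N (K n)) = emeasure N {p<..<u}"
        unfolding un[symmetric]
        by (rule SUP_emeasure_incseq[OF _ inc]; auto simp: K_def M(2) setsN)+
      then show ?thesis by (simp add: K)
    qed
    then show "emeasure M' {x<..} = emeasure N {x<..}"
      using emM'[of "{x<..}"] emN'[of "{x<..}"] unfolding I by simp
  qed
  then have "emeasure M A = emeasure N A"
    using emM'[OF A(1)] A(2) by (simp add: Int_absorb2)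
  also have "\<dots> = (\<integral>\<^sup>+x\<in>A. ennreal (w x) \<partial>lborel)"
    unfolding emN[OF A(1)] using A(2) by (intro nn_integral_cong) (auto simp: v_def split: split_indicator)
  finally show ?thesis .
qed

text \<open>
If the measure has a density on \<open>A\<close>, every Lebesgue decomposition has that density on \<open>A\<close>. A
decomposition comes from a null set \<open>Z\<close> of largest measure, which exists as a countable union because
the measure is finite: restricted to \<open>Z\<close> the measure is singular, and by maximality its restriction to
the complement vanishes on null sets.
\<close>

lemma ac_component_density_onI:
  assumes M: "finite_measure M" "sets M = sets borel"
    and w: "set_borel_measurable lborel A w" "\<And>x. x \<in> A \<Longrightarrow> 0 \<le> w x"
    and A: "\<And>B. B \<in> sets borel \<Longrightarrow> B \<subseteq> A \<Longrightarrow> emeasure M B = (\<integral>\<^sup>+x\<in>B. ennreal (w x) \<partial>lborel)"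
  shows "ac_component_density_on M A w"
proof -
  interpret finite_measure M by fact
  have ne: "null_sets (lborel :: real measure) \<noteq> {}" by auto
  obtain g :: "nat \<Rightarrow> ennreal" where g: "range g \<subseteq> emeasure M ` null_sets lborel"
      "(SUP Z\<in>null_sets lborel. emeasure M Z) = (SUP i. g i)"
    using ennreal_SUP_countable_SUP[OF ne] by blast
  then have "\<forall>i. \<exists>Y. Y \<in> null_sets lborel \<and> g i = emeasure M Y" by blast
  then obtain f where "\<forall>i. f i \<in> null_sets lborel \<and> g i = emeasure M (f i)" by metis
  with g have f: "range f \<subseteq> null_sets lborel"
      "(SUP Z\<in>null_sets lborel. emeasure M Z) = (SUP i. emeasure M (f i))"
    by auto
  define Z where "Z = (\<Union>i. f i)"
  have Z: "Z \<in> null_sets lborel" unfolding Z_def using f(1) by (intro null_sets_UN) auto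
  then have Zb: "Z \<in> sets borel" by (auto dest: null_setsD2)
  have maximal: "emeasure M (Y - Z) = 0" if Y: "Y \<in> null_sets lborel" for Y
  proof -
    have Yb: "Y \<in> sets borel" using Y by (auto dest: null_setsD2)
    have "Y \<union> Z \<in> null_sets lborel" using Y Z by (rule null_sets.Un)
    then have "emeasure M (Y \<union> Z) \<le> (SUP Z\<in>null_sets lborel. emeasure M Z)"
      by (rule SUP_upper)
    also have "\<dots> \<le> emeasure M Z"
      unfolding f(2) using Zb M(2) by (intro SUP_least emeasure_mono) (auto simp: Z_def)
    finally have "emeasure M Z + emeasure M (Y - Z) \<le> emeasure M Z"
      using Yb Zb M(2) by (subst plus_emeasure) (auto simp: Un_commute)
    then show ?thesis using emeasure_finite[of Z]
      by (metis add.right_neutral ennreal_add_left_cancel_le le_zero_eq top_neq_ennreal infinity_ennreal_def)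
  qed
  define N where "N = density M (indicator (UNIV - Z))"
  define S where "S = density M (indicator Z)"
  have dens: "emeasure (density M (indicator C)) B = emeasure M (B \<inter> C)" if "B \<in> sets borel" "C \<in> sets borel" for B C
    using that M(2)
    by (subst emeasure_restricted) (simp_all add: Int_commute)
  have emN: "emeasure N B = emeasure M (B - Z)" if "B \<in> sets borel" for B
    unfolding N_def using that Zb by (subst dens) (auto simp: Diff_eq)
  have emS: "emeasure S B = emeasure M (B \<inter> Z)" if "B \<in> sets borel" for B
    unfolding S_def using that Zb by (subst dens) auto
  have decomposition: "sets N = sets borel \<and> sets S = sets borel \<and>
        (\<forall>B\<in>sets borel. emeasure M B = emeasure N B + emeasure S B) \<and>
        absolutely_continuous lborel N \<and>
        (\<exists>Z\<in>null_sets lborel. emeasure S (UNIV - Z) = 0) \<and>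
        (\<forall>B\<in>sets borel. B \<subseteq> A \<longrightarrow> emeasure N B = (\<integral>\<^sup>+x\<in>B. ennreal (w x) \<partial>lborel))"
  proof (intro conjI ballI impI)
    show "sets N = sets borel" "sets S = sets borel" using M(2) by (simp_all add: N_def S_def)
    fix B :: "real set" assume B: "B \<in> sets borel"
    show "emeasure M B = emeasure N B + emeasure S B"
    proof -
      have "emeasure M (B - Z) + emeasure M (B \<inter> Z) = emeasure M ((B - Z) \<union> (B \<inter> Z))"
        using B Zb M(2) by (intro plus_emeasure) auto
      then show ?thesis by (simp only: emN[OF B] emS[OF B] Un_Diff_Int)
    qed
    assume BA: "B \<subseteq> A"
    have "emeasure N B = (\<integral>\<^sup>+x\<in>B - Z. ennreal (w x) \<partial>lborel)"
      unfolding emN[OF B] using B Zb BA by (intro A) auto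
    also have "\<dots> = (\<integral>\<^sup>+x\<in>B. ennreal (w x) \<partial>lborel)"
      using AE_not_in[OF Z] by (intro nn_integral_cong_AE) (auto split: split_indicator)
    finally show "emeasure N B = (\<integral>\<^sup>+x\<in>B. ennreal (w x) \<partial>lborel)" .
  next
    show "absolutely_continuous lborel N"
      unfolding absolutely_continuous_def
    proof
      fix Y :: "real set" assume Y: "Y \<in> null_sets lborel"
      then have "Y \<in> sets borel" by (auto dest: null_setsD2)
      with maximal[OF Y] show "Y \<in> null_sets N"
        using M(2) by (auto simp: emN intro!: null_setsI) (simp add: N_def M(2))
    qed
    show "\<exists>Z\<in>null_sets lborel. emeasure S (UNIV - Z) = 0"
    proof (rule bexI[OF _ Z])
      have "(UNIV - Z) \<inter> Z = {}" by blast
      then show "emeasure S (UNIV - Z) = 0" using Zb by (simp add: emS)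
    qed
  qed
  show ?thesis
    unfolding ac_component_density_on_def
    by (intro conjI ballI w, assumption, rule exI, rule exI, rule decomposition)
qed

section \<open>The Cauchy transform of an orthogonality measure\<close>

text \<open>
The solution of \<open>\<rho> + 1 / \<rho> = 2 * z\<close> in the unit disc, for \<open>z\<close> in the upper half-plane. With the
principal square root it is continuous up to the interval \<open>(-1, 1)\<close>, where it becomes
\<open>exp (- \<i> * \<theta>)\<close>.
\<close>

definition inner_root :: "complex \<Rightarrow> complex" where
  "inner_root z = z - \<i> * csqrt (1 - z\<^sup>2)"

lemma inner_root_quadratic: "inner_root z * (2 * z - inner_root z) = 1"
  using power2_csqrt[of "1 - z\<^sup>2"]
  by (simp add: inner_root_def algebra_simps power2_eq_square)

lemma inner_root_nonzero: "inner_root z \<noteq> 0"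
  using inner_root_quadratic[of z] by auto

lemma inner_root_add_inverse: "inner_root z + 1 / inner_root z = 2 * z"
  using inner_root_quadratic[of z] inner_root_nonzero[of z] by (simp add: field_simps)

text \<open>
The other root \<open>\<sigma>\<close> is the inverse of \<open>inner_root z\<close>. Its imaginary part is positive, and so is
that of \<open>\<sigma> + 1 / \<sigma>\<close>, which is \<open>Im \<sigma> * (1 - 1 / \<bar>\<sigma>\<bar>\<^sup>2)\<close>; this forces \<open>\<bar>\<sigma>\<bar> > 1\<close>.
\<close>

lemma norm_inner_root_less_1:
  assumes "0 < Im z"
  shows "norm (inner_root z) < 1"
proof -
  define \<sigma> where "\<sigma> = z + \<i> * csqrt (1 - z\<^sup>2)"
  have "inner_root z * \<sigma> = 1"
    using inner_root_quadratic[of z] by (simp add: \<sigma>_def inner_root_def algebra_simps del: csqrt.simps)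
  then have inv: "inner_root z = inverse \<sigma>"
    by (metis inverse_unique mult.commute)
  have Im: "0 < Im \<sigma>"
    using assms Re_csqrt[of "1 - z\<^sup>2"] by (simp add: \<sigma>_def del: csqrt.simps)
  then have nz: "0 < (norm \<sigma>)\<^sup>2" by auto
  have "\<sigma> + inverse \<sigma> = 2 * z"
    unfolding inv[symmetric] by (simp add: \<sigma>_def inner_root_def del: csqrt.simps)
  then have "Im \<sigma> + Im (inverse \<sigma>) = 2 * Im z"
    by (drule_tac arg_cong[where f=Im]) simp
  then have "0 < Im \<sigma> - Im \<sigma> / (norm \<sigma>)\<^sup>2"
    using assms by (simp add: cmod_power2)
  then have "Im \<sigma> * 1 < Im \<sigma> * (norm \<sigma>)\<^sup>2"
    using nz by (simp add: field_simps)
  then have "1 < (norm \<sigma>)\<^sup>2" using Im by (simp only: mult_less_cancel_left_pos)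
  then have "1 < norm \<sigma>" by (smt (verit) power_le_one norm_ge_zero)
  then show ?thesis unfolding inv by (simp add: norm_inverse inverse_less_1_iff)
qed

lemma continuous_inner_root:
  "continuous_on {z. 0 \<le> Im z \<and> \<bar>Re z\<bar> < 1} inner_root"
proof -
  have "1 - z\<^sup>2 \<notin> \<real>\<^sub>\<le>\<^sub>0" if "0 \<le> Im z" "\<bar>Re z\<bar> < 1" for z
  proof
    assume "1 - z\<^sup>2 \<in> \<real>\<^sub>\<le>\<^sub>0"
    then have Im: "Re z * Im z = 0" and Re: "1 + (Im z)\<^sup>2 \<le> (Re z)\<^sup>2"
      by (auto simp: complex_nonpos_Reals_iff power2_eq_square)
    have "(Re z)\<^sup>2 < 1" using that by (simp add: abs_square_less_1)
    with Re show False by (smt (verit) zero_le_power2)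
  qed
  then have "continuous_on {z. 0 \<le> Im z \<and> \<bar>Re z\<bar> < 1} (\<lambda>z. csqrt (1 - z\<^sup>2))"
    by (intro continuous_on_compose2[OF continuous_on_csqrt] continuous_intros) auto
  then show ?thesis unfolding inner_root_def
    by (intro continuous_intros)
qed

lemma inner_root_cos:
  assumes "0 < \<theta>" "\<theta> < pi"
  shows "inner_root (of_real (cos \<theta>)) = exp (- \<i> * of_real \<theta>)"
proof -
  have "1 - (of_real (cos \<theta>))\<^sup>2 = complex_of_real ((sin \<theta>)\<^sup>2)"
    by (simp add: sin_squared_eq)
  then have "csqrt (1 - (of_real (cos \<theta>))\<^sup>2) = of_real (sin \<theta>)"
    using of_real_sqrt[of "(sin \<theta>)\<^sup>2"] sin_gt_zero[OF assms] by (simp del: of_real_power csqrt.simps)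
  then show ?thesis
    by (simp add: inner_root_def complex_eq_iff Re_exp Im_exp del: csqrt.simps)
qed

lemma orth_product_integral:
  assumes "orthogonality_measure q b lam P M"
  shows "integrable M (\<lambda>x. poly (P n) x * poly (P m) x)"
    and "(\<integral>x. poly (P n) x * poly (P m) x \<partial>M) = (if m = n then qpoch (- (lam * q / b)) q n / 4 ^ n else 0)"
  using assms by (simp_all add: orthogonality_measure_def)

lemma orth_polys_measure_finite:
  assumes "orthogonality_measure q b lam P M" "P 0 = 1"
  shows "finite_measure M" "measure M UNIV = 1" "space M = UNIV" "sets M = sets borel"
proof -
  show s: "sets M = sets borel" using assms(1) by (simp add: orthogonality_measure_def)
  show sp: "space M = UNIV" using sets_eq_imp_space_eq[OF s] by simp
  have "integrable M (\<lambda>x. poly (P 0) x * poly (P 0) x)" "(\<integral>x. poly (P 0) x * poly (P 0) x \<partial>M) = 1"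
    using orth_product_integral[OF assms(1), of 0 0] by (simp_all add: qpoch_def)
  then have i: "integrable M (\<lambda>x. 1::real)" and e: "(\<integral>x. 1 \<partial>M) = (1::real)"
    by (simp_all add: assms(2))
  then have "emeasure M (space M) < \<infinity>"
    unfolding integrable_iff_bounded by simp
  then show "finite_measure M" by (intro finite_measureI) simp
  show "measure M UNIV = 1" using e sp by simp
qed

text \<open>
The resolvent is at most \<open>1 / Im z\<close> and the measure has total mass one, so the function of the second
kind is at most the \<open>L\<^sup>2\<close> norm of \<open>P k\<close> divided by \<open>Im z\<close>. The orthogonality relation gives that norm.
\<close>

lemma second_kind_bounded:
  assumes P: "orth_polys q c b lam P" and M: "orthogonality_measure q b lam P M"
    and pos: "\<And>k::nat. k \<ge> 1 \<Longrightarrow> 1 + lam / b * q ^ k > 0" and z: "0 < Im z"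
  shows "integrable M (\<lambda>t. of_real (poly (P k) t) / (of_real t - z))" (is "integrable M ?f")
    and "norm (\<integral>t. of_real (poly (P k) t) / (of_real t - z) \<partial>M) \<le> sqrt (weight_prod q (lam / b) k) / 2 ^ k / Im z"
proof -
  have P0: "P 0 = 1" using P by (simp add: orth_polys_def)
  note fin = orth_polys_measure_finite[OF M P0]
  interpret finite_measure M by (fact fin(1))
  have ik: "integrable M (\<lambda>x. poly (P k) x)"
    using orth_product_integral(1)[OF M, of k 0] by (simp add: P0)
  have i2: "integrable M (\<lambda>x. (poly (P k) x)\<^sup>2)"
    unfolding power2_eq_square by (rule orth_product_integral(1)[OF M])
  define s where "s = sqrt (weight_prod q (lam / b) k) / 2 ^ k"
  have wp: "weight_prod q (lam / b) k > 0" by (rule weight_prod_pos[OF pos])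
  then have s: "0 < s" by (simp add: s_def)
  have "qpoch (- (lam * q / b)) q k = weight_prod q (lam / b) k"
    by (simp add: qpoch_def weight_prod_def mult_ac)
  then have "(\<integral>x. (poly (P k) x)\<^sup>2 \<partial>M) = weight_prod q (lam / b) k / 4 ^ k"
    unfolding power2_eq_square by (simp add: orth_product_integral(2)[OF M])
  also have "\<dots> = s\<^sup>2"
  proof -
    have "(2 ^ k)\<^sup>2 = (4 :: real) ^ k" by (simp add: power2_eq_square power_mult_distrib[symmetric])
    then show ?thesis using wp by (simp add: s_def power_divide)
  qed
  finally have sq: "(\<integral>x. (poly (P k) x)\<^sup>2 \<partial>M) = s\<^sup>2" .
  have [measurable]: "poly (P k) \<in> borel_measurable borel"
    by (intro borel_measurable_continuous_onI continuous_intros)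
  have mf: "?f \<in> borel_measurable M"
    unfolding measurable_cong_sets[OF fin(4) refl] by measurable
  have nf: "norm (?f t) \<le> \<bar>poly (P k) t\<bar> / Im z" for t
    using mult_left_mono[OF norm_resolvent_le[OF z, of t], of "\<bar>poly (P k) t\<bar>"]
    by (simp add: norm_divide)
  have iabs: "integrable M (\<lambda>t. \<bar>poly (P k) t\<bar> / Im z)" using ik by simp
  show i: "integrable M ?f"
    by (rule Bochner_Integration.integrable_bound[OF iabs mf]) (use nf z in \<open>auto simp del: norm_divide\<close>)
  \<comment> \<open>The inequality \<open>\<bar>p\<bar> \<le> (s + p\<^sup>2 / s) / 2\<close> with \<open>s\<close> the \<open>L\<^sup>2\<close> norm replaces Cauchy-Schwarz.\<close>
  have "norm (\<integral>t. ?f t \<partial>M) \<le> (\<integral>t. \<bar>poly (P k) t\<bar> / Im z \<partial>M)"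
    by (rule Bochner_Integration.integral_norm_bound_integral[OF i iabs nf])
  also have "\<dots> \<le> (\<integral>t. (s + (poly (P k) t)\<^sup>2 / s) / 2 / Im z \<partial>M)"
  proof (rule Bochner_Integration.integral_mono[OF iabs])
    show "integrable M (\<lambda>t. (s + (poly (P k) t)\<^sup>2 / s) / 2 / Im z)" using i2 by simp
    fix t
    have "0 \<le> (\<bar>poly (P k) t\<bar> - s)\<^sup>2" by simp
    then have "2 * \<bar>poly (P k) t\<bar> * s \<le> s\<^sup>2 + (poly (P k) t)\<^sup>2" by (simp add: power2_diff)
    then have "\<bar>poly (P k) t\<bar> \<le> (s + (poly (P k) t)\<^sup>2 / s) / 2"
      using s by (simp add: field_simps power2_eq_square[of s])
    then show "\<bar>poly (P k) t\<bar> / Im z \<le> (s + (poly (P k) t)\<^sup>2 / s) / 2 / Im z"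
      using z by (intro divide_right_mono) auto
  qed
  also have "\<dots> = (s * measure M UNIV + s\<^sup>2 / s) / 2 / Im z"
    using i2 by (simp add: sq fin(3))
  also have "\<dots> = s / Im z" using s by (simp add: fin(2) power2_eq_square)
  finally show "norm (\<integral>t. ?f t \<partial>M) \<le> sqrt (weight_prod q (lam / b) k) / 2 ^ k / Im z"
    by (simp add: s_def)
qed

definition second_kind :: "(nat \<Rightarrow> real poly) \<Rightarrow> real measure \<Rightarrow> complex \<Rightarrow> nat \<Rightarrow> complex" where
  "second_kind P M z k = (\<integral>t. of_real (poly (P k) t) / (of_real t - z) \<partial>M)"

text \<open>
The scaling is the one that turns the recurrence of the polynomials into \<open>solves_rec\<close>. The
boundary value \<open>- 2\<close> encodes the inhomogeneous term \<open>1\<close>, the total mass, in the first equation of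
\<open>second_kind_recurrence\<close>.
\<close>

definition bounded_solution ::
  "real \<Rightarrow> real \<Rightarrow> (nat \<Rightarrow> real poly) \<Rightarrow> real measure \<Rightarrow> complex \<Rightarrow> nat \<Rightarrow> complex" where
  "bounded_solution q r P M z n =
     (case n of 0 \<Rightarrow> - 2 | Suc k \<Rightarrow> 2 ^ k * second_kind P M z k / of_real (weight_prod q r k))"

text \<open>
Write \<open>t * P k t / (t - z) = z * P k t / (t - z) + P k t\<close>; the integral of \<open>P k\<close> vanishes for
\<open>k > 0\<close> since \<open>P k\<close> is orthogonal to \<open>P 0 = 1\<close>.
\<close>

lemma second_kind_recurrence:
  assumes P: "orth_polys q c b lam P" and M: "orthogonality_measure q b lam P M"
    and pos: "\<And>k::nat. k \<ge> 1 \<Longrightarrow> 1 + lam / b * q ^ k > 0" and z: "0 < Im z"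
  defines "Q \<equiv> second_kind P M z"
  shows "z * Q 0 + 1 = Q 1 + of_real c * Q 0"
    and "z * Q (Suc k) = Q (Suc (Suc k)) + of_real (c * q ^ Suc k) * Q (Suc k)
        + of_real (1 / 4 * (1 + lam / b * q ^ Suc k)) * Q k"
proof -
  have P0: "P 0 = 1" and P1: "P 1 = [:- c, 1:]"
    and PS: "[:0, 1:] * P (Suc k) = P (Suc (Suc k)) + smult (c * q ^ Suc k) (P (Suc k))
          + smult (1 / 4 * (1 + lam * q ^ Suc k / b)) (P k)" for k
    using P by (auto simp: orth_polys_def)
  note fin = orth_polys_measure_finite[OF M P0]
  note i = second_kind_bounded(1)[OF P M pos z]
  have nz: "of_real t - z \<noteq> 0" for t :: real using z by (auto simp: complex_eq_iff)
  have int: "(\<integral>t. of_real (poly (P k) t) \<partial>M) = (if k = 0 then 1 else 0 :: complex)" "integrable M (\<lambda>t. complex_of_real (poly (P k) t))" for k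
  proof -
    note orth_product_integral[OF M, of k 0]
    then show "integrable M (\<lambda>t. complex_of_real (poly (P k) t))"
      "(\<integral>t. of_real (poly (P k) t) \<partial>M) = (if k = 0 then 1 else 0 :: complex)"
      by (auto simp: P0 qpoch_def)
  qed
  have lin: "(\<integral>t. f t + x * g t + y * h t \<partial>M) = (\<integral>t. f t \<partial>M) + x * (\<integral>t. g t \<partial>M) + y * (\<integral>t. h t \<partial>M)"
    if "integrable M f" "integrable M g" "integrable M h" for f g h :: "real \<Rightarrow> complex" and x y
    using that by simp
  have shift: "(\<integral>t. of_real t * of_real (poly (P k) t) / (of_real t - z) \<partial>M) = z * Q k + (if k = 0 then 1 else 0)" for k
  proof -
    have "of_real t * of_real (poly (P k) t) / (of_real t - z)
        = z * (of_real (poly (P k) t) / (of_real t - z)) + of_real (poly (P k) t)" for t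
      using nz[of t] by (simp add: field_simps)
    then have "(\<integral>t. of_real t * of_real (poly (P k) t) / (of_real t - z) \<partial>M)
       = (\<integral>t. z * (of_real (poly (P k) t) / (of_real t - z)) + of_real (poly (P k) t) \<partial>M)"
      by simp
    also have "\<dots> = z * Q k + (if k = 0 then 1 else 0)"
      unfolding Q_def second_kind_def
      by (subst Bochner_Integration.integral_add) (simp_all only: int integral_mult_right_zero integrable_mult_right i)
    finally show ?thesis .
  qed
  have "z * Q 0 + 1 = (\<integral>t. of_real t * of_real (poly (P 0) t) / (of_real t - z) \<partial>M)"
    by (simp add: shift)
  also have "\<dots> = (\<integral>t. of_real (poly (P 1) t) / (of_real t - z) + of_real c * (of_real (poly (P 0) t) / (of_real t - z)) \<partial>M)"
    by (intro Bochner_Integration.integral_cong refl) (simp add: P0 P1[unfolded One_nat_def] diff_divide_distrib)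
  also have "\<dots> = Q 1 + of_real c * Q 0"
    unfolding Q_def second_kind_def
    by (subst Bochner_Integration.integral_add) (simp_all only: int integral_mult_right_zero integrable_mult_right i)
  finally show "z * Q 0 + 1 = Q 1 + of_real c * Q 0" .
  have "z * Q (Suc k) = (\<integral>t. of_real t * of_real (poly (P (Suc k)) t) / (of_real t - z) \<partial>M)"
    by (simp add: shift)
  also have "\<dots> = (\<integral>t. of_real (poly (P (Suc (Suc k))) t) / (of_real t - z)
      + of_real (c * q ^ Suc k) * (of_real (poly (P (Suc k)) t) / (of_real t - z))
      + of_real (1 / 4 * (1 + lam / b * q ^ Suc k)) * (of_real (poly (P k) t) / (of_real t - z)) \<partial>M)"
  proof (intro Bochner_Integration.integral_cong refl)
    fix t
    have "t * poly (P (Suc k)) t = poly (P (Suc (Suc k))) t + c * q ^ Suc k * poly (P (Suc k)) t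
         + 1 / 4 * (1 + lam / b * q ^ Suc k) * poly (P k) t"
      using arg_cong[OF PS[of k], of "\<lambda>p. poly p t"] by simp
    then have "complex_of_real t * of_real (poly (P (Suc k)) t) = of_real (poly (P (Suc (Suc k))) t) + of_real (c * q ^ Suc k) * of_real (poly (P (Suc k)) t)
         + of_real (1 / 4 * (1 + lam / b * q ^ Suc k)) * of_real (poly (P k) t)"
      by (simp only: of_real_mult[symmetric] of_real_add[symmetric])
    then show "complex_of_real t * of_real (poly (P (Suc k)) t) / (of_real t - z) =
      of_real (poly (P (Suc (Suc k))) t) / (of_real t - z)
      + of_real (c * q ^ Suc k) * (of_real (poly (P (Suc k)) t) / (of_real t - z))
      + of_real (1 / 4 * (1 + lam / b * q ^ Suc k)) * (of_real (poly (P k) t) / (of_real t - z))"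
      by (simp only: add_divide_distrib times_divide_eq_right)
  qed
  also have "\<dots> = Q (Suc (Suc k)) + of_real (c * q ^ Suc k) * Q (Suc k)
        + of_real (1 / 4 * (1 + lam / b * q ^ Suc k)) * Q k"
    unfolding Q_def second_kind_def by (rule lin[OF i i i])
  finally show "z * Q (Suc k) = Q (Suc (Suc k)) + of_real (c * q ^ Suc k) * Q (Suc k)
        + of_real (1 / 4 * (1 + lam / b * q ^ Suc k)) * Q k" .
qed

lemma bounded_solution_solves_rec:
  assumes P: "orth_polys q c b lam P" and M: "orthogonality_measure q b lam P M"
    and pos: "\<And>k::nat. k \<ge> 1 \<Longrightarrow> 1 + lam / b * q ^ k > 0" and z: "0 < Im z"
  shows "solves_rec q c (lam / b) (2 * z) (bounded_solution q (lam / b) P M z)"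
  unfolding solves_rec_def
proof
  fix n
  let ?r = "lam / b" and ?Q = "second_kind P M z" and ?u = "bounded_solution q (lam / b) P M z"
  let ?D = "\<lambda>k. complex_of_real (weight_prod q (lam / b) k)"
  let ?a = "\<lambda>k. 1 + of_real (lam / b) * of_real q ^ k :: complex"
  note rec = second_kind_recurrence[OF P M pos z]
  have D: "?D k \<noteq> 0" for k
    using weight_prod_pos[OF pos, where n=k] by simp
  have a: "?a (Suc k) \<noteq> 0" for k
  proof -
    have "?a (Suc k) = of_real (1 + lam / b * q ^ Suc k)" by simp
    moreover have "1 + lam / b * q ^ Suc k \<noteq> 0" using pos[of "Suc k"] by linarith
    ultimately show ?thesis by (simp only: of_real_eq_0_iff not_False_eq_True)
  qed
  have DS: "?D (Suc k) = ?D k * ?a (Suc k)" for k by (simp add: weight_prod_def)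
  have u: "?u (Suc k) = 2 ^ k * ?Q k / ?D k" for k by (simp add: bounded_solution_def)
  have cancel: "x * (y / (d * x)) = y / d" if "x \<noteq> 0" for x y d :: complex
    using that by simp
  have up: "?a (Suc k) * ?u (Suc (Suc k)) = 2 * 2 ^ k * ?Q (Suc k) / ?D k" for k
    unfolding u DS cancel[OF a] by simp
  show "2 * z * ?u (Suc n) = ?a (Suc n) * ?u (Suc (Suc n)) + 2 * of_real c * of_real q ^ n * ?u (Suc n) + ?u n"
  proof (cases n)
    case 0
    have "?u 0 = - 2" by (simp add: bounded_solution_def)
    then show ?thesis
      using up[of 0] u[of 0] arg_cong[OF rec(1), of "\<lambda>w. 2 * w"]
      unfolding 0 by (simp add: weight_prod_def algebra_simps)
  next
    case (Suc k)
    let ?E = "2 * 2 ^ n / ?D n"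
    have "?u n = 2 ^ k * (?a n * ?Q k) / ?D n"
      unfolding Suc u DS using cancel[OF a[of k], of "2 ^ k * ?Q k" "?D k"]
      by (simp only: times_divide_eq_right mult.left_commute)
    also have "\<dots> = ?E * (?a n / 4 * ?Q k)"
      by (simp add: Suc)
    finally have un: "?u n = ?E * (?a n / 4 * ?Q k)" .
    have "2 * z * ?u (Suc n) = ?E * (z * ?Q n)"
      unfolding u by simp
    also have "z * ?Q n = ?Q (Suc n) + of_real c * of_real q ^ n * ?Q n + ?a n / 4 * ?Q k"
      using rec(2)[of k] by (simp add: Suc)
    also have "?E * \<dots> = ?E * ?Q (Suc n) + ?E * (of_real c * of_real q ^ n * ?Q n) + ?E * (?a n / 4 * ?Q k)"
      by (simp only: distrib_left)
    also have "?E * ?Q (Suc n) = ?a (Suc n) * ?u (Suc (Suc n))"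
      unfolding up by simp
    also have "?E * (of_real c * of_real q ^ n * ?Q n) = 2 * of_real c * of_real q ^ n * ?u (Suc n)"
      unfolding u by simp
    finally show ?thesis unfolding un[symmetric] .
  qed
qed

context q_recurrence
begin

text \<open>
The norm of \<open>P k\<close> compensates the scaling up to \<open>1 / sqrt (weight_prod q r k)\<close>, which converges
because the infinite product is positive.
\<close>

lemma bounded_solution_bounded:
  assumes P: "orth_polys q c b lam P" and M: "orthogonality_measure q b lam P M"
    and pos: "\<And>k::nat. k \<ge> 1 \<Longrightarrow> 1 + lam / b * q ^ k > 0" and z: "0 < Im z"
    and r: "r = lam / b"
  shows "\<exists>B. \<forall>n. norm (bounded_solution q r P M z n) \<le> B"
proof -
  let ?D = "weight_prod q r"
  have pos': "\<And>k::nat. k \<ge> 1 \<Longrightarrow> 1 + r * q ^ k > 0" using pos r by simp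
  note lim = weight_prod_limit[OF pos']
  have Dp: "?D k > 0" for k by (rule weight_prod_pos[OF pos'])
  have "(\<lambda>k. 1 / sqrt (?D k) / Im z) \<longlonglongrightarrow> 1 / sqrt (qpoch_inf (- (r * q)) q) / Im z"
    using lim z by (intro tendsto_intros) auto
  then have "Bseq (\<lambda>k. 1 / sqrt (?D k) / Im z)" by (intro convergent_imp_Bseq convergentI)
  then obtain K where K: "\<And>k. norm (1 / sqrt (?D k) / Im z) \<le> K" by (auto simp: Bseq_def)
  have "norm (bounded_solution q r P M z n) \<le> max 2 K" for n
  proof (cases n)
    case (Suc k)
    have "norm (bounded_solution q r P M z n) = 2 ^ k / ?D k * norm (second_kind P M z k)"
      using Dp[of k] by (simp add: bounded_solution_def Suc norm_mult norm_divide norm_power)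
    also have "\<dots> \<le> 2 ^ k / ?D k * (sqrt (?D k) / 2 ^ k / Im z)"
      unfolding second_kind_def r using second_kind_bounded(2)[OF P M pos z, of k] Dp[of k]
      by (intro mult_left_mono) (simp_all add: r)
    also have "\<dots> = 1 / sqrt (?D k) / Im z"
      using sqrt_divide_self_eq[of "?D k"] Dp[of k] by (simp add: divide_inverse mult_ac)
    also have "\<dots> \<le> K" using K[of k] by (simp only: real_norm_def)
    finally show ?thesis by simp
  qed (simp add: bounded_solution_def)
  then show ?thesis by blast
qed

lemma cauchy_transform_eq:
  assumes P: "orth_polys q c b lam P" and M: "orthogonality_measure q b lam P M"
    and pos: "\<And>k::nat. k \<ge> 1 \<Longrightarrow> 1 + lam / b * q ^ k > 0" and z: "0 < Im z"
    and r: "r = lam / b"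
  shows "jost q c r (inner_root z) 0 \<noteq> 0"
    and "cauchy_transform M z = - 2 * (jost q c r (inner_root z) 1 / jost q c r (inner_root z) 0)"
proof -
  obtain B where B: "norm (bounded_solution q r P M z n) \<le> B" for n
    using bounded_solution_bounded[OF P M pos z r] by blast
  have pos': "\<And>k::nat. k \<ge> 1 \<Longrightarrow> 1 + r * q ^ k > 0" using pos r by simp
  have s: "solves_rec q c r (inner_root z + 1 / inner_root z) (bounded_solution q r P M z)"
    unfolding inner_root_add_inverse r by (rule bounded_solution_solves_rec[OF P M pos z])
  have u0: "bounded_solution q r P M z 0 = - 2" by (simp add: bounded_solution_def)
  have "P 0 = 1" using P by (simp add: orth_polys_def)
  then have u1: "bounded_solution q r P M z 1 = cauchy_transform M z"
    by (simp add: bounded_solution_def second_kind_def cauchy_transform_def weight_prod_def)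
  have "bounded_solution q r P M z 0 \<noteq> 0" using u0 by simp
  note * = bounded_solution_ratio[OF pos' norm_inner_root_less_1[OF z] inner_root_nonzero s this B]
  show "jost q c r (inner_root z) 0 \<noteq> 0"
    and "cauchy_transform M z = - 2 * (jost q c r (inner_root z) 1 / jost q c r (inner_root z) 0)"
    using * unfolding u0 u1 by auto
qed

end

section \<open>The density\<close>

text \<open>
The Cauchy transform written with the Jost solution; unlike the integral, it also makes sense on
\<open>(-1, 1)\<close>.
\<close>

definition weyl :: "real \<Rightarrow> real \<Rightarrow> real \<Rightarrow> complex \<Rightarrow> complex" where
  "weyl q c r z = - 2 * (jost q c r (inner_root z) 1 / jost q c r (inner_root z) 0)"

context q_recurrence
begin

lemma continuous_jost: "continuous_on (cball 0 1) (\<lambda>\<rho>. jost q c r \<rho> n)"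
proof -
  have "norm (of_real q ^ n :: complex) \<le> 1"
    using q1 by (auto simp: norm_power intro!: power_le_one)
  then show ?thesis
    unfolding jost_def by (intro continuous_intros continuous_jost_series)
qed

lemma jost_0_nonzero_on_circle:
  assumes pos: "\<And>k::nat. k \<ge> 1 \<Longrightarrow> 1 + r * q ^ k > 0"
    and "norm \<rho> = 1" "Im \<rho> \<noteq> 0"
  shows "jost q c r \<rho> 0 \<noteq> 0"
proof
  assume z: "jost q c r \<rho> 0 = 0"
  have "jost q c r (cnj \<rho>) 0 = 0" using cnj_jost[of \<rho> 0] assms(2) z by simp
  with z jost_wronskian[OF pos assms(2)]
  have "complex_of_real (qpoch_inf (- (r * q)) q) * (\<rho> - cnj \<rho>) = 0" by simp
  then show False
    using weight_prod_limit(2)[OF pos] assms(3) by (auto simp: complex_eq_iff)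
qed

text \<open>
The denominator has no zero: inside the disc by comparison with the bounded solution that the measure
provides, on the circle by the Wronskian.
\<close>

lemma weyl_continuous:
  assumes P: "orth_polys q c b lam P" and M: "orthogonality_measure q b lam P M"
    and pos: "\<And>k::nat. k \<ge> 1 \<Longrightarrow> 1 + lam / b * q ^ k > 0" and r: "r = lam / b"
  shows "continuous_on {z. 0 \<le> Im z \<and> \<bar>Re z\<bar> < 1} (weyl q c r)"
proof -
  let ?D = "{z. 0 \<le> Im z \<and> \<bar>Re z\<bar> < 1}"
  have pos': "\<And>k::nat. k \<ge> 1 \<Longrightarrow> 1 + r * q ^ k > 0" using pos r by simp
  have D: "norm (inner_root z) \<le> 1 \<and> jost q c r (inner_root z) 0 \<noteq> 0" if z: "z \<in> ?D" for z
  proof (cases "Im z = 0")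
    case True
    define \<theta> where "\<theta> = arccos (Re z)"
    have c: "cos \<theta> = Re z" "0 < \<theta>" "\<theta> < pi"
      unfolding \<theta>_def using z arccos_lt_bounded[of "Re z"] by (simp_all add: abs_less_iff)
    have "z = of_real (cos \<theta>)" using True c by (simp add: complex_eq_iff)
    then have e: "inner_root z = exp (- \<i> * of_real \<theta>)" by (simp only: inner_root_cos[OF c(2,3)])
    have "norm (inner_root z) = 1" "Im (inner_root z) \<noteq> 0"
      unfolding e using sin_gt_zero[OF c(2,3)] by (simp_all add: Im_exp)
    then show ?thesis using jost_0_nonzero_on_circle[OF pos'] by simp
  next
    case False
    then have "0 < Im z" using z by simp
    then show ?thesis
      using norm_inner_root_less_1 cauchy_transform_eq(1)[OF P M pos _ r] by (simp add: less_imp_le)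
  qed
  have "continuous_on ?D (\<lambda>z. jost q c r (inner_root z) n)" for n
    using D by (intro continuous_on_compose2[OF continuous_jost continuous_inner_root]) auto
  then show ?thesis unfolding weyl_def using D by (intro continuous_intros) auto
qed

lemma mu_density_eq_jost:
  assumes pos: "\<And>k::nat. k \<ge> 1 \<Longrightarrow> 1 + r * q ^ k > 0" and r: "r = lam / b"
    and \<theta>: "0 < \<theta>" "\<theta> < pi"
  defines "\<rho> \<equiv> exp (\<i> * of_real \<theta>)"
  shows "of_real (mu_density q c b lam (cos \<theta>)) = 1 / (of_real pi * \<i>) *
     (jost q c r \<rho> 1 / jost q c r \<rho> 0 - jost q c r (cnj \<rho>) 1 / jost q c r (cnj \<rho>) 0)"
proof -
  let ?J = "jost q c r" and ?D = "qpoch_inf (- (r * q)) q"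
  have s: "0 < sin \<theta>" using sin_gt_zero \<theta> by simp
  have \<rho>: "norm \<rho> = 1" "Im \<rho> = sin \<theta>" by (simp_all add: \<rho>_def Im_exp)
  have J0: "?J \<rho> 0 \<noteq> 0" using jost_0_nonzero_on_circle[OF pos \<rho>(1)] \<rho>(2) s by simp
  have cn: "?J (cnj \<rho>) 0 = cnj (?J \<rho> 0)" using cnj_jost \<rho>(1) by simp
  have "\<rho>\<^sup>2 = exp (2 * \<i> * of_real \<theta>)"
    by (simp add: \<rho>_def exp_double[symmetric] mult.assoc)
  then have "R_fun q c b lam \<theta> = - 1 / (\<i> * of_real (sin \<theta>)) * G_series q c b lam \<rho>"
    by (simp add: R_fun_def G_series_def \<rho>_def)
  then have R: "cmod (R_fun q c b lam \<theta>) = cmod (?J \<rho> 0) / sin \<theta>"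
    using s by (simp add: G_series_eq r norm_mult norm_divide)
  have "sqrt (1 - (cos \<theta>)\<^sup>2) = sin \<theta>"
    using s by (simp add: sin_squared_eq[symmetric])
  then have mu: "mu_density q c b lam (cos \<theta>) = 2 * ?D * sin \<theta> / (pi * (cmod (?J \<rho> 0))\<^sup>2)"
    using s \<theta> by (simp add: mu_density_def arccos_cos R r power2_eq_square)
  have "?J \<rho> 1 / ?J \<rho> 0 - ?J (cnj \<rho>) 1 / ?J (cnj \<rho>) 0
     = (?J \<rho> 1 * ?J (cnj \<rho>) 0 - ?J \<rho> 0 * ?J (cnj \<rho>) 1) / (?J \<rho> 0 * ?J (cnj \<rho>) 0)"
    using J0 cn by (simp add: diff_frac_eq mult.commute)
  also have "\<dots> = of_real ?D * (\<rho> - cnj \<rho>) / of_real ((cmod (?J \<rho> 0))\<^sup>2)"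
    using jost_wronskian[OF pos \<rho>(1)] by (simp only: cn complex_norm_square)
  also have "\<rho> - cnj \<rho> = 2 * \<i> * of_real (sin \<theta>)"
    using \<rho>(2) by (simp add: complex_eq_iff)
  finally show ?thesis
    unfolding mu by simp
qed

text \<open>
The boundary value at \<open>cos \<theta>\<close> belongs to \<open>exp (- \<i> * \<theta>)\<close>, the lower half of the circle, and the two
terms of the Wronskian identity are conjugate to each other.
\<close>

lemma mu_density_eq_weyl:
  assumes pos: "\<And>k::nat. k \<ge> 1 \<Longrightarrow> 1 + r * q ^ k > 0" and r: "r = lam / b"
    and x: "-1 < x" "x < 1"
  shows "pi * mu_density q c b lam x = Im (weyl q c r (of_real x))"
proof -
  define \<theta> where "\<theta> = arccos x"
  have \<theta>: "x = cos \<theta>" "0 < \<theta>" "\<theta> < pi"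
    unfolding \<theta>_def using x arccos_lt_bounded[of x] by simp_all
  define \<rho> where "\<rho> = exp (\<i> * of_real \<theta>)"
  have c: "inner_root (of_real x) = cnj \<rho>"
    unfolding \<theta>(1) \<rho>_def inner_root_cos[OF \<theta>(2,3)] by (simp add: exp_cnj)
  define W where "W = jost q c r (cnj \<rho>) 1 / jost q c r (cnj \<rho>) 0"
  have "norm (cnj \<rho>) \<le> 1" by (simp add: \<rho>_def)
  then have "jost q c r \<rho> 1 / jost q c r \<rho> 0 = cnj W"
    unfolding W_def using cnj_jost[of "cnj \<rho>"] by simp
  then have "complex_of_real (mu_density q c b lam x) = 1 / (of_real pi * \<i>) * (cnj W - W)"
    using mu_density_eq_jost[OF pos r \<theta>(2,3)] unfolding W_def \<theta>(1) \<rho>_def by simp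
  also have "cnj W - W = - 2 * \<i> * of_real (Im W)" by (simp add: complex_eq_iff)
  finally have "complex_of_real (mu_density q c b lam x) = complex_of_real (- 2 * Im W / pi)"
    by simp
  then have "mu_density q c b lam x = - 2 * Im W / pi" by (simp only: of_real_eq_iff)
  then show ?thesis unfolding weyl_def c W_def[symmetric] by simp
qed

lemma orthogonality_measure_ac_density:
  assumes P: "orth_polys q c b lam P" and M: "orthogonality_measure q b lam P M"
    and pos: "\<And>k::nat. k \<ge> 1 \<Longrightarrow> 1 + lam / b * q ^ k > 0" and r: "r = lam / b"
  shows "ac_component_density_on M {-1<..<1} (mu_density q c b lam)"
proof -
  let ?A = "{-1<..<1} :: real set" and ?w = "mu_density q c b lam"
  let ?D = "{z. 0 \<le> Im z \<and> \<bar>Re z\<bar> < 1}" and ?e = "\<lambda>n. inverse (real (Suc n))"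
  have pos': "\<And>k::nat. k \<ge> 1 \<Longrightarrow> 1 + r * q ^ k > 0" using pos r by simp
  have "P 0 = 1" using P by (simp add: orth_polys_def)
  note fin = orth_polys_measure_finite[OF M this]
  note wc = weyl_continuous[OF P M pos r]
  have w: "?w x = Im (weyl q c r (of_real x)) / pi" if "x \<in> ?A" for x
    using mu_density_eq_weyl[OF pos' r, of x] that by (simp add: field_simps)
  have tr: "cauchy_transform M z = weyl q c r z" if "0 < Im z" for z
    unfolding weyl_def by (rule cauchy_transform_eq(2)[OF P M pos that r])
  have e0: "0 < ?e n" for n by simp
  have "continuous_on ?A (\<lambda>x. weyl q c r (of_real x))"
    by (rule continuous_on_compose2[OF wc]) (auto intro!: continuous_intros)
  then have "continuous_on ?A (\<lambda>x. Im (weyl q c r (of_real x)) / pi)"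
    by (intro continuous_intros) auto
  then have "continuous_on ?A ?w"
    by (rule continuous_on_eq) (simp add: w)
  then have wm: "set_borel_measurable lborel ?A ?w"
    unfolding set_borel_measurable_def
    using borel_measurable_continuous_on_indicator[of ?A ?w] by simp
  have lim: "(\<lambda>n. Im (cauchy_transform M (Complex x (?e n)))) \<longlonglongrightarrow> pi * ?w x" if x: "x \<in> ?A" for x
  proof -
    have "(\<lambda>n. Complex x (?e n)) \<longlonglongrightarrow> Complex x 0"
      by (intro tendsto_Complex tendsto_const LIMSEQ_inverse_real_of_nat)
    from continuous_on_tendsto_compose[OF wc this]
    have "(\<lambda>n. weyl q c r (Complex x (?e n))) \<longlonglongrightarrow> weyl q c r (Complex x 0)"
      using x by (simp add: abs_less_iff)
    then have "(\<lambda>n. Im (weyl q c r (Complex x (?e n)))) \<longlonglongrightarrow> Im (weyl q c r (Complex x 0))"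
      by (rule tendsto_Im)
    moreover have "Complex x 0 = of_real x" by (simp add: complex_eq_iff)
    ultimately show ?thesis using x by (simp add: tr w)
  qed
  have bound: "\<exists>B. \<forall>x\<in>{a..b'}. \<forall>n. Im (cauchy_transform M (Complex x (?e n))) \<le> B"
    if ab: "-1 < a" "b' < 1" for a b'
  proof -
    let ?K = "cbox (Complex a 0) (Complex b' 1)"
    have K: "?K \<subseteq> ?D" using ab by (auto simp: cbox_def Basis_complex_def abs_less_iff)
    have "compact (weyl q c r ` ?K)"
      by (intro compact_continuous_image continuous_on_subset[OF wc K] compact_cbox)
    then obtain B where B: "\<And>z. z \<in> ?K \<Longrightarrow> norm (weyl q c r z) \<le> B"
      using compact_imp_bounded bounded_iff by (metis imageI)
    have "Im (cauchy_transform M (Complex x (?e n))) \<le> B" if "x \<in> {a..b'}" for x n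
    proof -
      have "?e n \<le> 1" by (simp add: inverse_le_1_iff)
      then have "Complex x (?e n) \<in> ?K"
        using that e0[of n] by (auto simp: cbox_def Basis_complex_def simp del: of_nat_Suc)
      from B[OF this] show ?thesis
        using abs_Im_le_cmod[of "weyl q c r (Complex x (?e n))"] tr[of "Complex x (?e n)"] by simp
    qed
    then show ?thesis by blast
  qed
  show ?thesis
  proof (rule ac_component_density_onI[OF fin(1,4) wm])
    fix x assume x: "x \<in> ?A"
    have "0 \<le> pi * ?w x"
      by (rule LIMSEQ_le_const[OF lim[OF x]]) (use Im_cauchy_transform(2)[OF fin(1,4) e0] in auto)
    then show "0 \<le> ?w x" using pi_gt_zero zero_le_mult_iff[of pi "?w x"] by linarith
  next
    fix B assume "B \<in> sets borel" "B \<subseteq> ?A"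
    then show "emeasure M B = (\<integral>\<^sup>+x\<in>B. ennreal (?w x) \<partial>lborel)"
      by (intro stieltjes_inversion[OF fin(1,4) lim bound wm])
  qed
qed

end

theorem theorem4p2:
  fixes q c b lam :: real and P :: "nat \<Rightarrow> real poly"
  assumes "0 < \<bar>q\<bar>" and "\<bar>q\<bar> < 1" and "b < 0"
    and "\<forall>k\<ge>1::nat. 1 + lam * q ^ k / b > 0"
    and "orth_polys q c b lam P"
  shows "(\<forall>M. orthogonality_measure q b lam P M \<longrightarrow>
              ac_component_density_on M {-1<..<1} (mu_density q c b lam)) \<and>
         (\<forall>x\<in>{-1<..<1}. \<forall>\<theta>\<in>{0<..<pi}. x = cos \<theta> \<longrightarrow>
            (let \<rho>\<^sub>1 = exp (- \<i> * of_real \<theta>); \<rho>\<^sub>2 = exp (\<i> * of_real \<theta>);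
                 F = F_series q c b lam; G = G_series q c b lam
             in of_real (mu_density q c b lam x) =
                1 / (of_real pi * \<i>) * (\<rho>\<^sub>2 * (F \<rho>\<^sub>2 / G \<rho>\<^sub>2) - \<rho>\<^sub>1 * (F \<rho>\<^sub>1 / G \<rho>\<^sub>1))))"
proof -
  interpret q_recurrence q c "lam / b"
    using assms(2) by unfold_locales
  have pos: "1 + lam / b * q ^ k > 0" if "k \<ge> 1" for k :: nat
    using assms(4) that by simp
  show ?thesis
  proof (intro conjI allI ballI impI)
    fix M assume "orthogonality_measure q b lam P M"
    then show "ac_component_density_on M {-1<..<1} (mu_density q c b lam)"
      by (rule orthogonality_measure_ac_density[OF assms(5) _ pos refl])
  next
    fix x \<theta> :: real assume \<theta>: "\<theta> \<in> {0<..<pi}" and x: "x = cos \<theta>"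
    have "exp (- \<i> * of_real \<theta>) = cnj (exp (\<i> * of_real \<theta>))"
      by (simp add: exp_cnj)
    then show "let \<rho>\<^sub>1 = exp (- \<i> * of_real \<theta>); \<rho>\<^sub>2 = exp (\<i> * of_real \<theta>);
                 F = F_series q c b lam; G = G_series q c b lam
             in of_real (mu_density q c b lam x) =
                1 / (of_real pi * \<i>) * (\<rho>\<^sub>2 * (F \<rho>\<^sub>2 / G \<rho>\<^sub>2) - \<rho>\<^sub>1 * (F \<rho>\<^sub>1 / G \<rho>\<^sub>1))"
      using mu_density_eq_jost[OF pos refl, of \<theta>] \<theta>
      unfolding x Let_def times_divide_eq_right F_series_eq G_series_eq by simp
  qed
qed

end
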